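(* Assume that $\langle\mathcal L r,r\rangle\ge\lambda\|r\|^2$ for all $r\in H^1_0(\Omega)$, where $\lambda\ge0$ is some constant. Suppose that a unique solution $u$ of $$\sum_{i=1}^\ell q_i(t)D_t^{\alpha_i}u(x,t)+\mathcal L u(x,t)=f(x,t)\ \text{ in }\Omega\times(0,T],\quad u(\cdot,0)=u_0\text{ in }\Omega,\quad u=0\text{ on }\partial\Omega\times(0,T],$$ and its approximation $u_h$ are in $C([0,T];L_2(\Omega))\cap W^{1,\infty}(\epsilon,T;L_2(\Omega))$ for each $\epsilon\in(0,T]$, and also in $H^1_0(\Omega)$ for each $t>0$. Let $R_h(\cdot,t):=\bigl(\sum_{i=1}^\ell q_i(t)D_t^{\alpha_i}+\mathcal L\bigr)u_h(\cdot,t)-f(\cdot,t)$. If $\bigl(\sum_{i=1}^\ell q_i(t)D_t^{\alpha_i}+\lambda\bigr)^{-1}\|R_h(\cdot,t)\|$ exists, then $$\|(u_h-u)(\cdot,t)\|\le\Bigl(\sum_{i=1}^\ell q_i(t)D_t^{\alpha_i}+\lambda\Bigr)^{-1}\|R_h(\cdot,t)\|\qquad\text{for }t>0.$$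
   Context: $\Omega\subset\mathbb R^d$, $d\in\{1,2,3\}$, is a bounded Lipschitz domain; $T>0$; $\mathcal L$ is a spatial linear second-order elliptic operator; $\|\cdot\|$ and $\langle\cdot,\cdot\rangle$ are the norm and inner product of $L_2(\Omega)$. $\ell$ is a positive integer; $0<\alpha_\ell<\dots<\alpha_1\le1$ are constants; $q_i\in C[0,T]$ with $q_i\ge0$ and $\sum_{i=1}^\ell q_i(t)>0$ on $[0,T]$. For $\alpha_i<1$ and $0<t\le T$, $$\Gamma(1-\alpha_i)\,D_t^{\alpha_i}y(\cdot,t)=t^{-\alpha_i}[y(\cdot,t)-y(\cdot,0)]+\int_0^t\alpha_i(t-s)^{-\alpha_i-1}[y(\cdot,t)-y(\cdot,s)]\,ds,$$ and $D_t^1y:=\partial_ty$ (piecewise continuous time derivatives are regarded as left-continuous on $(0,T]$). Standing assumption on the approximate solution $u_h$: $u_h(\cdot,0)=u(\cdot,0)$ on $\Omega$ and $u_h(x,t)=u(x,t)$ for $x\in\partial\Omega$, $t>0$. For a function $v$ of $t$, $\bigl(\sum_iq_iD_t^{\alpha_i}+\lambda\bigr)^{-1}v$ denotes the (necessarily unique) solution $w$, if it exists, of $\sum_{i=1}^\ell q_i(t)D_t^{\alpha_i}w(t)+\lambda w(t)=v(t)$ for $0<t\le T$, $w(0)=0$, where $w\in C[0,T]\cap W^{1,\infty}(\epsilon,t)$ for all $0<\epsilon<t\le T$ and, if $\alpha_1=1$, $w'$ is left-continuous on $(0,T]$ (possibly with jump discontinuities). *)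

theory Defs
  imports "HOL-Analysis.Analysis"
begin

section \<open>The Hilbert space of square-integrable functions\<close>

text \<open>
  The type \<open>'a l2\<close> consists of the classes, modulo equality almost everywhere, of square-integrable
  Borel functions with respect to Lebesgue measure. It is a separable Hilbert space, so that
  Bochner integrals of functions with values in it are available.
\<close>

definition square_integrable :: "('a::euclidean_space \<Rightarrow> real) \<Rightarrow> bool" where
  "square_integrable f \<longleftrightarrow> f \<in> borel_measurable lborel \<and> integrable lborel (\<lambda>x. (f x)\<^sup>2)"

lemma square_integrable_measurable:
  "square_integrable f \<Longrightarrow> f \<in> borel_measurable lborel"
  by (simp add: square_integrable_def)

lemma square_integrable_zero [simp]: "square_integrable (\<lambda>x. 0)"
  by (simp add: square_integrable_def)

lemma integrable_mult_square_integrable: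
  assumes "square_integrable f" "square_integrable g"
  shows "integrable lborel (\<lambda>x. f x * g x)"
proof (rule Bochner_Integration.integrable_bound)
  show "integrable lborel (\<lambda>x. (f x)\<^sup>2 + (g x)\<^sup>2)"
    using assms by (auto simp: square_integrable_def)
  show "(\<lambda>x. f x * g x) \<in> borel_measurable lborel"
    using assms by (auto simp: square_integrable_def)
  show "AE x in lborel. norm (f x * g x) \<le> norm ((f x)\<^sup>2 + (g x)\<^sup>2)"
  proof (rule AE_I2)
    fix x
    have "2 * (\<bar>f x\<bar> * \<bar>g x\<bar>) \<le> (f x)\<^sup>2 + (g x)\<^sup>2"
      using sum_squares_bound[of "\<bar>f x\<bar>" "\<bar>g x\<bar>"] by simp
    moreover have "0 \<le> \<bar>f x\<bar> * \<bar>g x\<bar>" by simp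
    ultimately have "\<bar>f x\<bar> * \<bar>g x\<bar> \<le> (f x)\<^sup>2 + (g x)\<^sup>2" by linarith
    then show "norm (f x * g x) \<le> norm ((f x)\<^sup>2 + (g x)\<^sup>2)"
      by (simp add: abs_mult)
  qed
qed

lemma square_integrable_scale: "square_integrable f \<Longrightarrow> square_integrable (\<lambda>x. c * f x)"
  by (auto simp: square_integrable_def power_mult_distrib)

lemma square_integrable_add:
  assumes "square_integrable f" "square_integrable g"
  shows "square_integrable (\<lambda>x. f x + g x)"
proof -
  have "integrable lborel (\<lambda>x. (f x)\<^sup>2 + 2 * (f x * g x) + (g x)\<^sup>2)"
    using assms integrable_mult_square_integrable[OF assms]
    by (auto simp: square_integrable_def)
  moreover have "(\<lambda>x. (f x + g x)\<^sup>2) = (\<lambda>x. (f x)\<^sup>2 + 2 * (f x * g x) + (g x)\<^sup>2)"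
    by (auto simp: power2_sum)
  ultimately show ?thesis
    using assms by (auto simp: square_integrable_def)
qed

lemma square_integrable_minus: "square_integrable f \<Longrightarrow> square_integrable (\<lambda>x. - f x)"
  by (auto simp: square_integrable_def)

lemma square_integrable_diff:
  "square_integrable f \<Longrightarrow> square_integrable g \<Longrightarrow> square_integrable (\<lambda>x. f x - g x)"
  using square_integrable_add[of f "\<lambda>x. - g x"] square_integrable_minus[of g] by simp

quotient_type (overloaded) 'a l2 = "'a::euclidean_space \<Rightarrow> real" / partial:
  "\<lambda>f g. square_integrable f \<and> square_integrable g \<and> (AE x in lborel. f x = g x)"
proof (rule part_equivpI)
  show "\<exists>f::'a \<Rightarrow> real. square_integrable f \<and> square_integrable f \<and> (AE x in lborel. f x = f x)"
    using square_integrable_zero by blast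
  show "symp (\<lambda>f g::'a \<Rightarrow> real. square_integrable f \<and> square_integrable g \<and> (AE x in lborel. f x = g x))"
  proof (rule sympI)
    fix f g :: "'a \<Rightarrow> real"
    assume fg: "square_integrable f \<and> square_integrable g \<and> (AE x in lborel. f x = g x)"
    then have "AE x in lborel. f x = g x" by blast
    then have "AE x in lborel. g x = f x" by eventually_elim simp
    with fg show "square_integrable g \<and> square_integrable f \<and> (AE x in lborel. g x = f x)"
      by blast
  qed
  show "transp (\<lambda>f g::'a \<Rightarrow> real. square_integrable f \<and> square_integrable g \<and> (AE x in lborel. f x = g x))"
  proof (rule transpI)
    fix f g h :: "'a \<Rightarrow> real"
    assume fg: "square_integrable f \<and> square_integrable g \<and> (AE x in lborel. f x = g x)"
      and gh: "square_integrable g \<and> square_integrable h \<and> (AE x in lborel. g x = h x)"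
    then have "AE x in lborel. f x = g x" "AE x in lborel. g x = h x" by blast+
    then have "AE x in lborel. f x = h x" by eventually_elim simp
    with fg gh show "square_integrable f \<and> square_integrable h \<and> (AE x in lborel. f x = h x)"
      by blast
  qed
qed

lemma AE_eq_cong2:
  assumes "AE x in M. f x = f' x" "AE x in M. g x = g' x"
  shows "AE x in M. h (f x) (g x) = h (f' x) (g' x)"
  using assms by eventually_elim simp

lemma AE_eq_cong1:
  assumes "AE x in M. f x = f' x"
  shows "AE x in M. h (f x) = h (f' x)"
  using assms by eventually_elim simp

instantiation l2 :: (euclidean_space) real_vector
begin

lift_definition zero_l2 :: "'a l2" is "\<lambda>x. 0" by simp

lift_definition plus_l2 :: "'a l2 \<Rightarrow> 'a l2 \<Rightarrow> 'a l2" is "\<lambda>f g x. f x + g x"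
  by (elim conjE, intro conjI, (rule square_integrable_add; assumption)+, rule AE_eq_cong2; assumption)

lift_definition minus_l2 :: "'a l2 \<Rightarrow> 'a l2 \<Rightarrow> 'a l2" is "\<lambda>f g x. f x - g x"
  by (elim conjE, intro conjI, (rule square_integrable_diff; assumption)+, rule AE_eq_cong2; assumption)

lift_definition uminus_l2 :: "'a l2 \<Rightarrow> 'a l2" is "\<lambda>f x. - f x"
  by (elim conjE, intro conjI, (rule square_integrable_minus; assumption)+, rule AE_eq_cong1; assumption)

lift_definition scaleR_l2 :: "real \<Rightarrow> 'a l2 \<Rightarrow> 'a l2" is "\<lambda>c f x. c * f x"
  by (elim conjE, intro conjI, (rule square_integrable_scale; assumption)+, rule AE_eq_cong1; assumption)

instance
proof
  fix f g h :: "'a l2" and a b :: real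
  note si = square_integrable_add square_integrable_diff square_integrable_minus
    square_integrable_scale square_integrable_zero
  show "f + g + h = f + (g + h)"
    by transfer (auto intro!: si simp: add.assoc)
  show "f + g = g + f"
    by transfer (auto intro!: si simp: add.commute)
  show "0 + f = f" "- f + f = 0" "f - g = f + - g"
    by (transfer; auto intro!: si)+
  show "a *\<^sub>R (f + g) = a *\<^sub>R f + a *\<^sub>R g" "(a + b) *\<^sub>R f = a *\<^sub>R f + b *\<^sub>R f"
    "a *\<^sub>R b *\<^sub>R f = (a * b) *\<^sub>R f"
    by (transfer; intro conjI AE_I2; (elim conjE, intro si, assumption+)?; simp add: algebra_simps)+
  show "1 *\<^sub>R f = f"
    by transfer simp
qed

end

instantiation l2 :: (euclidean_space) real_inner
begin

lift_definition inner_l2 :: "'a l2 \<Rightarrow> 'a l2 \<Rightarrow> real" is "\<lambda>f g. LINT x|lborel. f x * g x"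
proof -
  fix f f' g g' :: "'a \<Rightarrow> real"
  assume f: "square_integrable f \<and> square_integrable f' \<and> (AE x in lborel. f x = f' x)"
    and g: "square_integrable g \<and> square_integrable g' \<and> (AE x in lborel. g x = g' x)"
  then have [measurable]: "f \<in> borel_measurable lborel" "f' \<in> borel_measurable lborel"
      "g \<in> borel_measurable lborel" "g' \<in> borel_measurable lborel"
    by (simp_all add: square_integrable_def)
  from f g have "AE x in lborel. f x = f' x" "AE x in lborel. g x = g' x" by blast+
  then have "AE x in lborel. f x * g x = f' x * g' x" by eventually_elim simp
  then show "(LINT x|lborel. f x * g x) = (LINT x|lborel. f' x * g' x)"
    by (intro integral_cong_AE) measurable
qed

definition norm_l2 :: "'a l2 \<Rightarrow> real" where "norm_l2 f = sqrt (inner f f)"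
definition sgn_l2 :: "'a l2 \<Rightarrow> 'a l2" where "sgn_l2 f = f /\<^sub>R norm f"
definition dist_l2 :: "'a l2 \<Rightarrow> 'a l2 \<Rightarrow> real" where "dist_l2 f g = norm (f - g)"
definition uniformity_l2 :: "('a l2 \<times> 'a l2) filter" where
  "uniformity_l2 = (INF e\<in>{0<..}. principal {(x, y). dist x y < e})"
definition open_l2 :: "'a l2 set \<Rightarrow> bool" where
  "open_l2 U \<longleftrightarrow> (\<forall>x\<in>U. \<forall>\<^sub>F (x', y) in uniformity. x' = x \<longrightarrow> y \<in> U)"

instance
proof
  fix f g h :: "'a l2" and a b :: real
  show "f \<bullet> g = g \<bullet> f" by transfer (simp add: mult.commute)
  show "(f + g) \<bullet> h = f \<bullet> h + g \<bullet> h"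
    by transfer (simp add: distrib_right integrable_mult_square_integrable)
  show "a *\<^sub>R f \<bullet> g = a * (f \<bullet> g)"
    by transfer (simp add: mult.assoc)
  show "0 \<le> f \<bullet> f" by transfer simp
  show "f \<bullet> f = 0 \<longleftrightarrow> f = 0"
  proof transfer
    fix f :: "'a \<Rightarrow> real"
    assume "square_integrable f \<and> square_integrable f \<and> (AE x in lborel. f x = f x)"
    then have "square_integrable f" by simp
    moreover from this have "(LINT x|lborel. f x * f x) = 0 \<longleftrightarrow> (AE x in lborel. f x * f x = 0)"
      by (intro integral_nonneg_eq_0_iff_AE) (auto intro: integrable_mult_square_integrable)
    ultimately show "((LINT x|lborel. f x * f x) = 0) =
        (square_integrable f \<and> square_integrable (\<lambda>x. 0::real) \<and> (AE x in lborel. f x = 0))"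
      by simp
  qed
  show "dist f g = norm (f - g)" by (rule dist_l2_def)
  show "sgn f = f /\<^sub>R norm f" by (rule sgn_l2_def)
  show "norm f = sqrt (f \<bullet> f)" by (rule norm_l2_def)
  show "uniformity = (INF e\<in>{0<..}. principal {(x :: 'a l2, y). dist x y < e})"
    by (rule uniformity_l2_def)
  fix U :: "'a l2 set"
  show "open U \<longleftrightarrow> (\<forall>x\<in>U. \<forall>\<^sub>F (x', y) in uniformity. x' = x \<longrightarrow> y \<in> U)"
    by (rule open_l2_def)
qed

end

lemma square_integrable_rep_l2: "square_integrable (rep_l2 f)"
  using Quotient_rep_reflp[OF Quotient_l2] by blast

lemma abs_rep_l2 [simp]: "abs_l2 (rep_l2 f) = f"
  using Quotient_abs_rep[OF Quotient_l2] by blast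

lemma abs_l2_eq_iff: "square_integrable f \<Longrightarrow> square_integrable g \<Longrightarrow>
    abs_l2 f = abs_l2 g \<longleftrightarrow> (AE x in lborel. f x = g x)"
  using Quotient_rel[OF Quotient_l2, of f g] by auto

lemma rep_abs_l2: "square_integrable f \<Longrightarrow> AE x in lborel. rep_l2 (abs_l2 f) x = f x"
  using abs_l2_eq_iff[OF square_integrable_rep_l2, of f "abs_l2 f"] by simp

lemma inner_abs_l2: "square_integrable f \<Longrightarrow> square_integrable g \<Longrightarrow>
    abs_l2 f \<bullet> abs_l2 g = (LINT x|lborel. f x * g x)"
  by (simp add: inner_l2.abs_eq)

lemma diff_abs_l2: "square_integrable f \<Longrightarrow> square_integrable g \<Longrightarrow>
    abs_l2 f - abs_l2 g = abs_l2 (\<lambda>x. f x - g x)"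
  by (simp add: minus_l2.abs_eq)

lemma norm_abs_l2: "square_integrable f \<Longrightarrow> norm (abs_l2 f) = sqrt (LINT x|lborel. (f x)\<^sup>2)"
  by (simp add: norm_eq_sqrt_inner inner_abs_l2 power2_eq_square)

lemma norm_l2_eq: "norm f = sqrt (LINT x|lborel. (rep_l2 f x)\<^sup>2)"
  using norm_abs_l2[OF square_integrable_rep_l2[of f]] by simp

lemma nn_integral_diff_rep_l2:
  "(\<integral>\<^sup>+x. ennreal ((rep_l2 f x - rep_l2 g x)\<^sup>2) \<partial>lborel) = ennreal ((norm (f - g))\<^sup>2)"
proof -
  have s: "square_integrable (\<lambda>x. rep_l2 f x - rep_l2 g x)"
    by (intro square_integrable_diff square_integrable_rep_l2)
  have "f - g = abs_l2 (\<lambda>x. rep_l2 f x - rep_l2 g x)"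
    using diff_abs_l2[OF square_integrable_rep_l2[of f] square_integrable_rep_l2[of g]] by simp
  then have "(norm (f - g))\<^sup>2 = (LINT x|lborel. (rep_l2 f x - rep_l2 g x)\<^sup>2)"
    using norm_abs_l2[OF s] by simp
  moreover have "(\<integral>\<^sup>+x. ennreal ((rep_l2 f x - rep_l2 g x)\<^sup>2) \<partial>lborel)
      = ennreal (LINT x|lborel. (rep_l2 f x - rep_l2 g x)\<^sup>2)"
    using s by (intro nn_integral_eq_integral) (auto simp: square_integrable_def)
  ultimately show ?thesis by simp
qed

lemma square_integrable_iff_nn:
  "square_integrable f \<longleftrightarrow> f \<in> borel_measurable lborel \<and> (\<integral>\<^sup>+x. ennreal ((f x)\<^sup>2) \<partial>lborel) < \<infinity>"
  by (auto simp: square_integrable_def integrable_iff_bounded)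

lemma Fatou_l2:
  fixes X :: "nat \<Rightarrow> 'a::euclidean_space l2" and g :: "'a l2" and f :: "'a \<Rightarrow> real"
  assumes f [measurable]: "f \<in> borel_measurable lborel"
    and lim: "AE x in lborel. (\<lambda>j. rep_l2 (X j) x) \<longlonglongrightarrow> f x"
    and bound: "\<And>j. j \<ge> k \<Longrightarrow> (norm (X j - g))\<^sup>2 \<le> C"
  shows "(\<integral>\<^sup>+x. ennreal ((f x - rep_l2 g x)\<^sup>2) \<partial>lborel) \<le> ennreal C"
proof -
  have [measurable]: "rep_l2 h \<in> borel_measurable lborel" for h :: "'a l2"
    using square_integrable_rep_l2[of h] by (simp add: square_integrable_def)
  have "(\<integral>\<^sup>+x. ennreal ((f x - rep_l2 g x)\<^sup>2) \<partial>lborel)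
      \<le> (\<integral>\<^sup>+x. liminf (\<lambda>j. ennreal ((rep_l2 (X j) x - rep_l2 g x)\<^sup>2)) \<partial>lborel)"
  proof (rule nn_integral_mono_AE)
    from lim show "AE x in lborel. ennreal ((f x - rep_l2 g x)\<^sup>2)
        \<le> liminf (\<lambda>j. ennreal ((rep_l2 (X j) x - rep_l2 g x)\<^sup>2))"
    proof eventually_elim
      fix x assume "(\<lambda>j. rep_l2 (X j) x) \<longlonglongrightarrow> f x"
      then have "(\<lambda>j. ennreal ((rep_l2 (X j) x - rep_l2 g x)\<^sup>2)) \<longlonglongrightarrow> ennreal ((f x - rep_l2 g x)\<^sup>2)"
        by (intro tendsto_intros)
      then have "liminf (\<lambda>j. ennreal ((rep_l2 (X j) x - rep_l2 g x)\<^sup>2)) = ennreal ((f x - rep_l2 g x)\<^sup>2)"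
        by (intro lim_imp_Liminf) auto
      then show "ennreal ((f x - rep_l2 g x)\<^sup>2)
          \<le> liminf (\<lambda>j. ennreal ((rep_l2 (X j) x - rep_l2 g x)\<^sup>2))" by simp
    qed
  qed
  also have "\<dots> \<le> liminf (\<lambda>j. \<integral>\<^sup>+x. ennreal ((rep_l2 (X j) x - rep_l2 g x)\<^sup>2) \<partial>lborel)"
    by (rule nn_integral_liminf) measurable
  also have "\<dots> = liminf (\<lambda>j. ennreal ((norm (X j - g))\<^sup>2))"
    by (simp only: nn_integral_diff_rep_l2)
  also have "\<dots> \<le> ennreal C"
  proof (rule Liminf_le)
    show "\<forall>\<^sub>F j in sequentially. ennreal ((norm (X j - g))\<^sup>2) \<le> ennreal C"
      unfolding eventually_sequentially using bound by (auto intro!: exI[of _ k] ennreal_leI)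
  qed simp
  finally show ?thesis .
qed

lemma l2_fast_Cauchy_convergent:
  fixes Y :: "nat \<Rightarrow> 'a::euclidean_space l2"
  assumes Y: "\<And>k j. k \<le> j \<Longrightarrow> norm (Y j - Y k) \<le> (1/4)^k"
  shows "convergent Y"
proof -
  define F where "F k = rep_l2 (Y k)" for k
  have [measurable]: "F k \<in> borel_measurable lborel" for k
    using square_integrable_rep_l2[of "Y k"] by (simp add: square_integrable_def F_def)
  have Y2: "(norm (Y j - Y k))\<^sup>2 \<le> (1/16)^k" if "k \<le> j" for j k
  proof -
    have "(norm (Y j - Y k))\<^sup>2 \<le> ((1/4)^k)\<^sup>2"
      using Y[OF that] by (intro power_mono) auto
    also have "\<dots> = (1/16::real)^k"
      by (simp add: power2_eq_square flip: power_mult_distrib)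
    finally show ?thesis .
  qed
  define a where "a k x = 4^k * (F (Suc k) x - F k x)\<^sup>2" for k x
  have [measurable]: "a k \<in> borel_measurable lborel" for k
    unfolding a_def by measurable
  have a_nonneg: "0 \<le> a k x" for k x by (simp add: a_def)
  have a_int: "(\<integral>\<^sup>+x. ennreal (a k x) \<partial>lborel) \<le> ennreal ((1/4)^k)" for k
  proof -
    have "(\<integral>\<^sup>+x. ennreal (a k x) \<partial>lborel)
        = ennreal (4^k) * (\<integral>\<^sup>+x. ennreal ((F (Suc k) x - F k x)\<^sup>2) \<partial>lborel)"
      by (subst nn_integral_cmult[symmetric]) (auto simp: a_def ennreal_mult)
    also have "\<dots> = ennreal (4^k) * ennreal ((norm (Y (Suc k) - Y k))\<^sup>2)"
      by (simp add: F_def nn_integral_diff_rep_l2)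
    also have "\<dots> = ennreal (4^k * (norm (Y (Suc k) - Y k))\<^sup>2)"
      by (simp add: ennreal_mult)
    also have "\<dots> \<le> ennreal (4^k * (1/16)^k)"
      using Y2[of k "Suc k"] by (intro ennreal_leI mult_left_mono) auto
    also have "(4::real)^k * (1/16)^k = (1/4)^k"
      by (simp flip: power_mult_distrib)
    finally show ?thesis .
  qed
  have "(\<integral>\<^sup>+x. (\<Sum>k. ennreal (a k x)) \<partial>lborel) = (\<Sum>k. \<integral>\<^sup>+x. ennreal (a k x) \<partial>lborel)"
    by (rule nn_integral_suminf) measurable
  also have "\<dots> \<le> (\<Sum>k. ennreal ((1/4)^k))"
    using a_int by (intro suminf_le) auto
  also have "\<dots> = ennreal (\<Sum>k. (1/4)^k)"
    by (intro suminf_ennreal2) (auto intro: summable_geometric)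
  finally have "(\<integral>\<^sup>+x. (\<Sum>k. ennreal (a k x)) \<partial>lborel) \<noteq> \<infinity>"
    by (metis ennreal_less_top infinity_ennreal_def leD)
  then have "AE x in lborel. (\<Sum>k. ennreal (a k x)) \<noteq> \<infinity>"
    by (intro nn_integral_PInf_AE) auto
  then have conv: "AE x in lborel. convergent (\<lambda>k. F k x)"
  proof eventually_elim
    fix x assume "(\<Sum>k. ennreal (a k x)) \<noteq> \<infinity>"
    then have "summable (\<lambda>k. a k x)"
      using a_nonneg by (intro summable_suminf_not_top) auto
    then have "(\<lambda>k. a k x) \<longlonglongrightarrow> 0" by (rule summable_LIMSEQ_zero)
    then have "\<forall>\<^sub>F k in sequentially. a k x < 1"
      by (rule order_tendstoD) simp
    then have "\<forall>\<^sub>F k in sequentially. norm (F (Suc k) x - F k x) \<le> (1/2)^k"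
    proof eventually_elim
      fix k assume "a k x < 1"
      then have "(2^k * \<bar>F (Suc k) x - F k x\<bar>)\<^sup>2 \<le> 1\<^sup>2"
        by (simp add: a_def power_mult_distrib power_mult[symmetric] mult.commute[of k] power_mult)
      then have "2^k * \<bar>F (Suc k) x - F k x\<bar> \<le> 1"
        by (rule power2_le_imp_le) simp
      then show "norm (F (Suc k) x - F k x) \<le> (1/2)^k"
        by (simp add: power_one_over field_simps)
    qed
    then have "summable (\<lambda>k. F (Suc k) x - F k x)"
      by (rule summable_comparison_test_ev) (simp add: summable_geometric)
    then have "convergent (\<lambda>n. \<Sum>k<n. F (Suc k) x - F k x)"
      by (simp add: summable_iff_convergent)
    then have "convergent (\<lambda>n. F n x - F 0 x)"
      by (simp only: sum_lessThan_telescope[of "\<lambda>k. F k x"])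
    then have "convergent (\<lambda>n. (F n x - F 0 x) + F 0 x)"
      by (intro convergent_add convergent_const)
    then show "convergent (\<lambda>k. F k x)" by simp
  qed
  define f where "f x = lim (\<lambda>k. F k x)" for x
  have [measurable]: "f \<in> borel_measurable lborel"
    unfolding f_def by measurable
  have lim: "AE x in lborel. (\<lambda>j. rep_l2 (Y j) x) \<longlonglongrightarrow> f x"
    using conv by eventually_elim (simp add: f_def F_def convergent_LIMSEQ_iff)
  have est: "(\<integral>\<^sup>+x. ennreal ((f x - rep_l2 (Y k) x)\<^sup>2) \<partial>lborel) \<le> ennreal ((1/16)^k)" for k
    using lim Y2 by (intro Fatou_l2[where k = k]) auto
  have sd: "square_integrable (\<lambda>x. f x - rep_l2 (Y k) x)" for k
    unfolding square_integrable_iff_nn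
    using le_less_trans[OF est[of k]] by (auto simp flip: F_def)
  from square_integrable_add[OF sd[of 0] square_integrable_rep_l2[of "Y 0"]]
  have sf: "square_integrable f" by simp
  have norm_est: "norm (abs_l2 f - Y k) \<le> (1/4)^k" for k
  proof (rule power2_le_imp_le)
    have "abs_l2 f - Y k = abs_l2 (\<lambda>x. f x - rep_l2 (Y k) x)"
      using diff_abs_l2[OF sf square_integrable_rep_l2[of "Y k"]] by simp
    then have "(norm (abs_l2 f - Y k))\<^sup>2 = (LINT x|lborel. (f x - rep_l2 (Y k) x)\<^sup>2)"
      using norm_abs_l2[OF sd] by simp
    moreover have "ennreal (LINT x|lborel. (f x - rep_l2 (Y k) x)\<^sup>2) \<le> ennreal ((1/16)^k)"
      using est[of k] sd[of k] nn_integral_eq_integral[of lborel "\<lambda>x. (f x - rep_l2 (Y k) x)\<^sup>2"]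
      by (simp add: square_integrable_def)
    ultimately have "(norm (abs_l2 f - Y k))\<^sup>2 \<le> (1/16)^k"
      by (simp add: ennreal_le_iff)
    also have "\<dots> = ((1/4)^k)\<^sup>2"
      by (simp add: power2_eq_square flip: power_mult_distrib)
    finally show "(norm (abs_l2 f - Y k))\<^sup>2 \<le> ((1/4)^k)\<^sup>2" .
  qed simp
  have "Y \<longlonglongrightarrow> abs_l2 f"
  proof (rule Lim_null_comparison[of "\<lambda>k. Y k - abs_l2 f" "\<lambda>k. (1/4)^k", THEN LIM_zero_cancel])
    show "\<forall>\<^sub>F k in sequentially. norm (Y k - abs_l2 f) \<le> (1/4)^k"
      using norm_est by (auto simp: norm_minus_commute)
    show "(\<lambda>k. (1/4::real)^k) \<longlonglongrightarrow> 0" by (rule LIMSEQ_power_zero) simp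
  qed
  then show ?thesis by (rule convergentI)
qed

instance l2 :: (euclidean_space) banach
proof
  fix X :: "nat \<Rightarrow> 'a l2"
  assume X: "Cauchy X"
  have "\<exists>N. \<forall>m\<ge>N. \<forall>n\<ge>N. dist (X m) (X n) < (1/4)^k" for k :: nat
    using metric_CauchyD[OF X, of "(1/4)^k"] by auto
  then obtain N where N: "\<And>k m n. m \<ge> N k \<Longrightarrow> n \<ge> N k \<Longrightarrow> dist (X m) (X n) < (1/4::real)^k"
    by metis
  define r where "r k = k + (\<Sum>i\<le>k. N i)" for k :: nat
  have r_mono: "strict_mono r" by (rule strict_monoI_Suc) (simp add: r_def)
  have r_ge: "r k \<ge> N k" for k
    by (simp add: r_def trans_le_add2 member_le_sum)
  have "norm ((X \<circ> r) j - (X \<circ> r) k) \<le> (1/4)^k" if "k \<le> j" for j k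
  proof -
    have "r k \<le> r j" using r_mono that by (simp add: strict_mono_less_eq)
    then show ?thesis
      using N[where k = k and m = "r j" and n = "r k"] r_ge[of k] by (simp add: dist_norm)
  qed
  then have "convergent (X \<circ> r)" by (rule l2_fast_Cauchy_convergent)
  then obtain l where "(X \<circ> r) \<longlonglongrightarrow> l" by (auto simp: convergent_def)
  from Cauchy_converges_subseq[OF X r_mono this] show "convergent X"
    by (rule convergentI)
qed

lemma l2_dominated_convergence:
  fixes s :: "nat \<Rightarrow> 'a::euclidean_space \<Rightarrow> real"
  assumes s: "\<And>n. square_integrable (s n)" and f: "square_integrable f" and g: "square_integrable g"
    and lim: "\<And>x. (\<lambda>n. s n x) \<longlonglongrightarrow> f x"
    and bound: "\<And>n x. \<bar>s n x\<bar> \<le> g x"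
  shows "(\<lambda>n. abs_l2 (s n)) \<longlonglongrightarrow> abs_l2 f"
proof -
  have [measurable]: "s n \<in> borel_measurable lborel" for n
    using s[of n] by (simp add: square_integrable_def)
  have [measurable]: "f \<in> borel_measurable lborel"
    using f by (simp add: square_integrable_def)
  have fg: "\<bar>f x\<bar> \<le> g x" for x
    using tendsto_rabs[OF lim[of x]] by (rule LIMSEQ_le_const2) (simp add: bound)
  have "(\<lambda>n. LINT x|lborel. (s n x - f x)\<^sup>2) \<longlonglongrightarrow> (LINT x::'a|lborel. 0)"
  proof (rule integral_dominated_convergence)
    show "integrable lborel (\<lambda>x. 4 * (g x)\<^sup>2)"
      using g by (simp add: square_integrable_def)
    show "AE x in lborel. (\<lambda>n. (s n x - f x)\<^sup>2) \<longlonglongrightarrow> 0"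
    proof (rule AE_I2)
      fix x show "(\<lambda>n. (s n x - f x)\<^sup>2) \<longlonglongrightarrow> 0"
        using tendsto_power[OF LIM_zero[OF lim[of x]], of 2] by simp
    qed
    show "AE x in lborel. norm ((s n x - f x)\<^sup>2) \<le> 4 * (g x)\<^sup>2" for n
    proof (rule AE_I2)
      fix x
      have "\<bar>s n x - f x\<bar> \<le> 2 * g x"
        using bound[of n x] fg[of x] by linarith
      then have "\<bar>s n x - f x\<bar>\<^sup>2 \<le> (2 * g x)\<^sup>2"
        by (rule power_mono) simp
      then show "norm ((s n x - f x)\<^sup>2) \<le> 4 * (g x)\<^sup>2"
        by (simp add: power_mult_distrib)
    qed
    show "(\<lambda>x. 0) \<in> borel_measurable lborel" by simp
    show "(\<lambda>x. (s n x - f x)\<^sup>2) \<in> borel_measurable lborel" for n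
      by measurable
  qed
  then have "(\<lambda>n. sqrt (LINT x|lborel. (s n x - f x)\<^sup>2)) \<longlonglongrightarrow> sqrt 0"
    by (intro tendsto_real_sqrt) simp
  moreover have "norm (abs_l2 (s n) - abs_l2 f) = sqrt (LINT x|lborel. (s n x - f x)\<^sup>2)" for n
    using norm_abs_l2[OF square_integrable_diff[OF s[of n] f]] diff_abs_l2[OF s[of n] f] by simp
  ultimately have "(\<lambda>n. norm (abs_l2 (s n) - abs_l2 f)) \<longlonglongrightarrow> 0" by simp
  then show ?thesis by (rule LIM_zero_cancel[OF tendsto_norm_zero_cancel])
qed

lemma subspace_closure:
  fixes S :: "'b::real_normed_vector set"
  assumes "subspace S"
  shows "subspace (closure S)"
proof (rule subspaceI)
  show "0 \<in> closure S"
    using assms closure_subset subspace_0 by blast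
next
  fix x y assume "x \<in> closure S" "y \<in> closure S"
  then obtain f g where "\<And>n. f n \<in> S" "f \<longlonglongrightarrow> x" "\<And>n. g n \<in> S" "g \<longlonglongrightarrow> y"
    by (auto simp: closure_sequential)
  then show "x + y \<in> closure S"
    unfolding closure_sequential
    by (intro exI[of _ "\<lambda>n. f n + g n"]) (auto intro: tendsto_add subspace_add[OF assms])
next
  fix c :: real and x assume "x \<in> closure S"
  then obtain f where "\<And>n. f n \<in> S" "f \<longlonglongrightarrow> x"
    by (auto simp: closure_sequential)
  then show "c *\<^sub>R x \<in> closure S"
    unfolding closure_sequential
    by (intro exI[of _ "\<lambda>n. c *\<^sub>R f n"]) (auto intro: tendsto_intros subspace_scale[OF assms])
qed

lemma countable_dense_in_span:
  fixes S :: "'b::real_normed_vector set"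
  assumes "countable S"
  shows "\<exists>D. countable D \<and> closure (span S) \<subseteq> closure D"
proof (cases "S = {}")
  case True
  then show ?thesis by (intro exI[of _ "{0}"]) simp
next
  case False
  define c where "c l = (\<Sum>(q, n)\<leftarrow>l. of_rat q *\<^sub>R from_nat_into S n)" for l :: "(rat \<times> nat) list"
  define D where "D = range c"
  have D_add: "x + y \<in> D" if "x \<in> D" "y \<in> D" for x y
  proof -
    from that obtain l l' where "x = c l" "y = c l'" by (auto simp: D_def)
    then have "x + y = c (l @ l')" by (simp add: c_def)
    then show ?thesis by (auto simp: D_def)
  qed
  have c_scale: "of_rat q *\<^sub>R c l = c (map (\<lambda>(p, n). (q * p, n)) l)" for q l
    by (induction l) (auto simp: c_def scaleR_add_right of_rat_mult)
  have D_scale: "r *\<^sub>R x \<in> D" if r: "r \<in> \<rat>" and x: "x \<in> D" for r x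
  proof -
    from r obtain q where "r = of_rat q" by (auto simp: Rats_def)
    moreover from x obtain l where "x = c l" by (auto simp: D_def)
    ultimately show ?thesis using c_scale[of q l] by (auto simp: D_def)
  qed
  have "subspace (closure D)"
  proof (rule subspaceI)
    have "c [] \<in> D" by (simp add: D_def)
    then have "0 \<in> D" by (simp add: c_def)
    then show "0 \<in> closure D" using closure_subset by blast
  next
    fix x y assume "x \<in> closure D" "y \<in> closure D"
    then obtain f g where "\<And>n. f n \<in> D" "f \<longlonglongrightarrow> x" "\<And>n. g n \<in> D" "g \<longlonglongrightarrow> y"
      by (auto simp: closure_sequential)
    then show "x + y \<in> closure D"
      unfolding closure_sequential
      by (intro exI[of _ "\<lambda>n. f n + g n"]) (auto intro: tendsto_add D_add)
  next
    fix r :: real and x assume "x \<in> closure D"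
    then obtain f where f: "\<And>n. f n \<in> D" "f \<longlonglongrightarrow> x"
      by (auto simp: closure_sequential)
    have "r \<in> closure \<rat>" by (simp add: Rats_closure_real)
    then obtain q where "\<And>n. q n \<in> \<rat>" "q \<longlonglongrightarrow> r"
      by (auto simp: closure_sequential)
    with f show "r *\<^sub>R x \<in> closure D"
      unfolding closure_sequential
      by (intro exI[of _ "\<lambda>n. q n *\<^sub>R f n"]) (auto intro: tendsto_scaleR D_scale)
  qed
  moreover have "S \<subseteq> closure D"
  proof
    fix x assume "x \<in> S"
    then obtain n where "x = from_nat_into S n"
      using from_nat_into_surj[OF assms] by metis
    then have "x = c [(1, n)]" by (simp add: c_def)
    then have "x \<in> D" by (simp add: D_def)
    then show "x \<in> closure D" using closure_subset by blast
  qed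
  ultimately have "span S \<subseteq> closure D" by (intro span_minimal)
  then have "closure (span S) \<subseteq> closure D" by (simp add: closure_minimal)
  moreover have "countable D" by (simp add: D_def)
  ultimately show ?thesis by blast
qed

lemma countable_dense_imp_countable_subbasis:
  fixes D :: "'b::metric_space set"
  assumes D: "countable D" "closure D = UNIV"
  shows "\<exists>B::'b set set. countable B \<and> open = generate_topology B"
proof -
  define B where "B = (\<lambda>(d, n). ball d (1 / real (Suc n))) ` (D \<times> (UNIV::nat set))"
  have "topological_basis B"
  proof (rule topological_basisI)
    show "open b" if "b \<in> B" for b using that by (auto simp: B_def)
  next
    fix U :: "'b set" and x assume "open U" "x \<in> U"
    then obtain e where e: "e > 0" "ball x e \<subseteq> U" by (meson openE)
    obtain n where n: "1 / real (Suc n) < e / 2"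
      using nat_approx_posE[of "e / 2"] e by auto
    have "x \<in> closure D" by (simp add: D)
    then obtain d where d: "d \<in> D" "dist d x < 1 / real (Suc n)"
      using closure_approachable[of x D] by (metis of_nat_0_less_iff zero_less_Suc zero_less_divide_1_iff)
    have "ball d (1 / real (Suc n)) \<subseteq> ball x e"
    proof
      fix y assume "y \<in> ball d (1 / real (Suc n))"
      then have "dist d y < e / 2" using n by simp
      moreover have "dist x d < e / 2" using d n by (simp add: dist_commute)
      ultimately show "y \<in> ball x e" using dist_triangle[of x y d] by simp
    qed
    then show "\<exists>b\<in>B. x \<in> b \<and> b \<subseteq> U"
      using d e by (intro bexI[of _ "ball d (1 / real (Suc n))"]) (auto simp: B_def)
  qed
  moreover have "countable B" using D by (auto simp: B_def)
  ultimately show ?thesis using topological_basis_imp_subbasis by blast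
qed

lemma square_integrable_bounded_support:
  fixes f :: "'a::euclidean_space \<Rightarrow> real"
  assumes [measurable]: "f \<in> borel_measurable borel"
    and "\<And>x. \<bar>f x\<bar> \<le> C * indicator (cball 0 r) x"
  shows "square_integrable f"
  unfolding square_integrable_def
proof
  show "f \<in> borel_measurable lborel" by measurable
  show "integrable lborel (\<lambda>x. (f x)\<^sup>2)"
  proof (rule Bochner_Integration.integrable_bound)
    show "integrable lborel (\<lambda>x::'a. C\<^sup>2 * indicator (cball 0 r) x)"
      by (intro integrable_mult_right integrable_real_indicator emeasure_bounded_finite) auto
    show "AE x in lborel. norm ((f x)\<^sup>2) \<le> norm (C\<^sup>2 * indicator (cball 0 r) x :: real)"
    proof (rule AE_I2)
      fix x
      have "\<bar>f x\<bar>\<^sup>2 \<le> (C * indicator (cball 0 r) x)\<^sup>2"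
        by (rule power_mono) (use assms in auto)
      then show "norm ((f x)\<^sup>2) \<le> norm (C\<^sup>2 * indicator (cball 0 r) x :: real)"
        by (auto simp: indicator_def split: if_splits)
    qed
  qed measurable
qed

lemma l2_separable:
  "\<exists>S::'a::euclidean_space l2 set. countable S \<and> closure (span S) = UNIV"
proof -
  obtain B :: "'a set set" where B: "countable B" "topological_basis B"
    using ex_countable_basis by blast
  define G where "G = Inter ` {F. finite F \<and> F \<subseteq> B}"
  have "countable G"
    unfolding G_def using B by (intro countable_image countable_Collect_finite_subset)
  have G_open: "open A" if "A \<in> G" for A
    using that topological_basis_open[OF B(2)] by (auto simp: G_def intro!: open_Inter)
  have "B \<subseteq> G"
  proof
    fix b assume "b \<in> B"
    then show "b \<in> G" unfolding G_def by (intro image_eqI[of _ _ "{b}"]) auto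
  qed
  have G_basis: "topological_basis G"
  proof (rule topological_basisI)
    fix U :: "'a set" and x assume "open U" "x \<in> U"
    then obtain b where "b \<in> B" "x \<in> b" "b \<subseteq> U"
      using topological_basisE[OF B(2)] by metis
    with \<open>B \<subseteq> G\<close> show "\<exists>b\<in>G. x \<in> b \<and> b \<subseteq> U" by blast
  qed (rule G_open)
  have G_borel: "sets borel = sigma_sets UNIV G"
    by (subst borel_eq_countable_basis[OF \<open>countable G\<close> G_basis]) simp
  have G_Pow: "G \<subseteq> Pow UNIV" by simp
  have UNIV_G: "UNIV \<in> G"
    unfolding G_def by (intro image_eqI[of _ _ "{}"]) auto
  have G_Int: "Int_stable G"
  proof (rule Int_stableI)
    fix A A' assume "A \<in> G" "A' \<in> G"
    then obtain F F' where "finite F" "F \<subseteq> B" "A = \<Inter>F" "finite F'" "F' \<subseteq> B" "A' = \<Inter>F'"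
      by (auto simp: G_def)
    then show "A \<inter> A' \<in> G"
      unfolding G_def by (intro image_eqI[of _ _ "F \<union> F'"]) auto
  qed
  define Q where "Q n = cball (0::'a) (real n)" for n
  define ind where "ind n A = (indicator (A \<inter> Q n) :: 'a \<Rightarrow> real)" for n A
  have ind_si: "square_integrable (ind n A)" if "A \<in> sets borel" for n A
  proof (rule square_integrable_bounded_support)
    show "ind n A \<in> borel_measurable borel"
      unfolding ind_def Q_def using that by (intro borel_measurable_indicator sets.Int) auto
    show "\<bar>ind n A x\<bar> \<le> 1 * indicator (cball 0 (real n)) x" for x
      by (auto simp: ind_def Q_def indicator_def)
  qed
  define S where "S = (\<lambda>(n, A). abs_l2 (ind n A)) ` ((UNIV::nat set) \<times> G)"
  have "countable S" unfolding S_def using \<open>countable G\<close> by auto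
  define V where "V = closure (span S)"
  have V: "subspace V" unfolding V_def by (intro subspace_closure subspace_span)
  have V_closed: "x \<in> V" if "\<And>n. s n \<in> V" "s \<longlonglongrightarrow> x" for s x
    using closed_sequentially[of V s x] that by (simp add: V_def)
  have S_V: "abs_l2 (ind n A) \<in> V" if "A \<in> G" for n A
  proof -
    have "abs_l2 (ind n A) \<in> S" using that by (auto simp: S_def)
    then show ?thesis unfolding V_def using span_superset closure_subset by blast
  qed
  have ind_V: "abs_l2 (ind n A) \<in> V" if "A \<in> sets borel" for n A
    using that unfolding G_borel
  proof (induction rule: sigma_sets_induct_disjoint[OF G_Int G_Pow, consumes 1, case_names basic empty compl union])
    case (basic A)
    then show ?case by (rule S_V)
  next
    case empty
    have "ind n {} = (\<lambda>x. 0)" by (auto simp: ind_def)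
    then have "abs_l2 (ind n {}) = 0" by (simp add: zero_l2_def)
    then show ?case using subspace_0[OF V] by simp
  next
    case (compl A)
    then have A: "A \<in> sets borel" by (simp add: G_borel)
    have "ind n (UNIV - A) = (\<lambda>x. ind n UNIV x - ind n A x)"
      by (auto simp: ind_def indicator_def)
    then have "abs_l2 (ind n (UNIV - A)) = abs_l2 (ind n UNIV) - abs_l2 (ind n A)"
      using diff_abs_l2[OF ind_si[of UNIV n] ind_si[OF A, of n]] by simp
    then show ?case using subspace_diff[OF V S_V[OF UNIV_G] compl(2)] by simp
  next
    case (union A)
    then have A: "A i \<in> sets borel" for i by (auto simp: G_borel)
    have fin: "abs_l2 (ind n (\<Union>i<k. A i)) \<in> V" for k
    proof (induction k)
      case 0
      have "ind n {} = (\<lambda>x. 0)" by (auto simp: ind_def)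
    then have "abs_l2 (ind n {}) = 0" by (simp add: zero_l2_def)
      then show ?case using subspace_0[OF V] by simp
    next
      case (Suc k)
      have disj: "A k \<inter> A i = {}" if "i < k" for i
        using disjoint_family_onD[OF union(1), of k i] that by auto
      have "(\<Union>i<Suc k. A i) = (\<Union>i<k. A i) \<union> A k" by (auto simp: less_Suc_eq)
      moreover have "(\<Union>i<k. A i) \<inter> A k = {}" using disj by blast
      ultimately have "ind n (\<Union>i<Suc k. A i) = (\<lambda>x. ind n (\<Union>i<k. A i) x + ind n (A k) x)"
        by (auto simp: ind_def indicator_def fun_eq_iff)
      moreover have "square_integrable (ind n (\<Union>i<k. A i))" "square_integrable (ind n (A k))"
        using A by (auto intro!: ind_si)
      ultimately have "abs_l2 (ind n (\<Union>i<Suc k. A i)) = abs_l2 (ind n (\<Union>i<k. A i)) + abs_l2 (ind n (A k))"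
        by (simp add: plus_l2.abs_eq)
      then show ?case using subspace_add[OF V Suc.IH union(3)[of k]] by simp
    qed
    have "(\<lambda>k. abs_l2 (ind n (\<Union>i<k. A i))) \<longlonglongrightarrow> abs_l2 (ind n (\<Union>i. A i))"
    proof (rule l2_dominated_convergence[where g = "ind n UNIV"])
      show "square_integrable (ind n (\<Union>i<k. A i))" for k using A by (auto intro!: ind_si)
      show "square_integrable (ind n (\<Union>i. A i))" using A by (auto intro!: ind_si)
      show "square_integrable (ind n UNIV)" by (auto intro!: ind_si)
      show "\<bar>ind n (\<Union>i<k. A i) x\<bar> \<le> ind n UNIV x" for k x
        by (auto simp: ind_def indicator_def)
      show "(\<lambda>k. ind n (\<Union>i<k. A i) x) \<longlonglongrightarrow> ind n (\<Union>i. A i) x" for x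
      proof (cases "x \<in> (\<Union>i. A i)")
        case True
        then obtain i where i: "x \<in> A i" by blast
        have "\<forall>\<^sub>F k in sequentially. ind n (\<Union>i<k. A i) x = ind n (\<Union>i. A i) x"
          using eventually_gt_at_top[of i]
        proof eventually_elim
          case (elim k)
          then have "x \<in> (\<Union>i<k. A i)" using i by blast
          then show ?case using True by (simp add: ind_def indicator_def)
        qed
        then show ?thesis by (rule tendsto_eventually)
      next
        case False
        then have "ind n (\<Union>i<k. A i) x = ind n (\<Union>i. A i) x" for k
          by (auto simp: ind_def indicator_def)
        then show ?thesis by simp
      qed
    qed
    then show ?case by (rule V_closed[OF fin])
  qed
  have "abs_l2 f \<in> V" if f: "square_integrable f" for f :: "'a \<Rightarrow> real"
  proof -
    have fm [measurable]: "f \<in> borel_measurable lborel" using f by (simp add: square_integrable_def)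
    obtain s where s: "\<And>i. simple_function lborel (s i)" "\<And>x. (\<lambda>i. s i x) \<longlonglongrightarrow> f x"
        "\<And>i x. dist (s i x) 0 \<le> 2 * dist (f x) 0"
      using borel_measurable_implies_sequence_metric[OF fm, of 0] by auto
    have sm [measurable]: "s i \<in> borel_measurable lborel" for i
      using s(1) by (rule borel_measurable_simple_function)
    have fin: "finite (range (s i))" for i
      using simple_functionD(1)[OF s(1)[of i]] by simp
    define p where "p i x = s i x * ind i UNIV x" for i x
    have level: "s i -` {y} \<in> sets borel" for i y
      using measurable_sets[OF sm[of i], of "{y}"] by simp
    have sum_V: "square_integrable (\<lambda>x. \<Sum>y\<in>Y. y * ind i (s i -` {y}) x) \<and>
        abs_l2 (\<lambda>x. \<Sum>y\<in>Y. y * ind i (s i -` {y}) x) \<in> V" if "finite Y" for i Y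
      using that
    proof induction
      case empty
      show ?case using subspace_0[OF V] by (simp add: zero_l2_def)
    next
      case (insert y Y)
      have si: "square_integrable (\<lambda>x. y * ind i (s i -` {y}) x)"
        by (intro square_integrable_scale ind_si level)
      have "abs_l2 (\<lambda>x. y * ind i (s i -` {y}) x) = y *\<^sub>R abs_l2 (ind i (s i -` {y}))"
        by (simp add: scaleR_l2.abs_eq ind_si level)
      then have "abs_l2 (\<lambda>x. y * ind i (s i -` {y}) x) \<in> V"
        using subspace_scale[OF V ind_V[OF level]] by simp
      moreover have "abs_l2 (\<lambda>x. y * ind i (s i -` {y}) x + (\<Sum>y\<in>Y. y * ind i (s i -` {y}) x))
          = abs_l2 (\<lambda>x. y * ind i (s i -` {y}) x) + abs_l2 (\<lambda>x. \<Sum>y\<in>Y. y * ind i (s i -` {y}) x)"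
        using insert si by (simp add: plus_l2.abs_eq)
      ultimately show ?case
        using insert si by (simp add: square_integrable_add subspace_add[OF V])
    qed
    have p_eq: "p i = (\<lambda>x. \<Sum>y\<in>range (s i). y * ind i (s i -` {y}) x)" for i
    proof
      fix x
      have "(\<Sum>y\<in>range (s i). y * ind i (s i -` {y}) x)
          = (\<Sum>y\<in>range (s i). if y = s i x then s i x * ind i UNIV x else 0)"
        by (rule sum.cong) (auto simp: ind_def indicator_def)
      also have "\<dots> = p i x" using fin by (simp add: p_def)
      finally show "p i x = (\<Sum>y\<in>range (s i). y * ind i (s i -` {y}) x)" by simp
    qed
    have pV: "square_integrable (p i)" "abs_l2 (p i) \<in> V" for i
      using sum_V[OF fin[of i], of i] by (simp_all add: p_eq)
    have "(\<lambda>i. abs_l2 (p i)) \<longlonglongrightarrow> abs_l2 f"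
    proof (rule l2_dominated_convergence[where g = "\<lambda>x. 2 * \<bar>f x\<bar>"])
      show "square_integrable (\<lambda>x. 2 * \<bar>f x\<bar>)"
        using f by (intro square_integrable_scale) (auto simp: square_integrable_def)
      show "\<bar>p i x\<bar> \<le> 2 * \<bar>f x\<bar>" for i x
        using s(3)[of i x] by (auto simp: p_def ind_def indicator_def)
      show "(\<lambda>i. p i x) \<longlonglongrightarrow> f x" for x
      proof -
        obtain N where N: "norm x \<le> real N" using real_arch_simple by blast
        have "\<forall>\<^sub>F i in sequentially. s i x = p i x"
          using eventually_ge_at_top[of N]
        proof eventually_elim
          case (elim i)
          then have "x \<in> Q i" using N by (simp add: Q_def)
          then show ?case by (simp add: p_def ind_def)
        qed
        then show ?thesis using s(2)[of x] by (rule Lim_transform_eventually[rotated])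
      qed
    qed (use f pV in auto)
    then show ?thesis by (rule V_closed[OF pV(2)])
  qed
  then have "f \<in> V" for f
    using square_integrable_rep_l2[of f] abs_rep_l2[of f] by metis
  then have "V = UNIV" by blast
  then show ?thesis using \<open>countable S\<close> unfolding V_def by blast
qed

instance l2 :: (euclidean_space) second_countable_topology
proof
  obtain S :: "'a l2 set" where S: "countable S" "closure (span S) = UNIV"
    using l2_separable by blast
  obtain D where D: "countable D" "closure (span S) \<subseteq> closure D"
    using countable_dense_in_span[OF S(1)] by blast
  then have "closure D = UNIV" using S by auto
  from countable_dense_imp_countable_subbasis[OF D(1) this]
  show "\<exists>B::'a l2 set set. countable B \<and> open = generate_topology B" .
qed

section \<open>Function spaces\<close>

text \<open>
  \<open>L2 \<Omega>\<close> is realised as the closed subspace of \<open>L2(\<real>\<^sup>n)\<close> of classes vanishing almost everywhere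
  outside \<open>\<Omega>\<close>, i.e. functions on \<open>\<Omega>\<close> are extended by zero; norm and inner product are
  then those of the type \<^typ>\<open>'a l2\<close>.
\<close>

definition L2 :: "'a::euclidean_space set \<Rightarrow> 'a l2 set" where
  "L2 \<Omega> = {f. AE x in lborel. x \<notin> \<Omega> \<longrightarrow> rep_l2 f x = 0}"

definition Linf :: "'a::euclidean_space set \<Rightarrow> ('a \<Rightarrow> 'b::{banach, second_countable_topology}) \<Rightarrow> bool" where
  "Linf S g \<longleftrightarrow> set_borel_measurable lborel S g \<and>
     (\<exists>C. AE x in lborel. x \<in> S \<longrightarrow> norm (g x) \<le> C)"

definition loc_integrable :: "'a::euclidean_space set \<Rightarrow> ('a \<Rightarrow> real) \<Rightarrow> bool" where
  "loc_integrable \<Omega> g \<longleftrightarrow> (\<forall>K. compact K \<and> K \<subseteq> \<Omega> \<longrightarrow> set_integrable lborel K g)"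

primrec C_k :: "nat \<Rightarrow> ('a::euclidean_space \<Rightarrow> real) \<Rightarrow> bool" where
  "C_k 0 \<phi> \<longleftrightarrow> continuous_on UNIV \<phi>"
| "C_k (Suc k) \<phi> \<longleftrightarrow> (\<forall>x. \<phi> differentiable (at x)) \<and>
     (\<forall>v\<in>Basis. C_k k (\<lambda>x. frechet_derivative \<phi> (at x) v))"

definition test_fun :: "'a::euclidean_space set \<Rightarrow> ('a \<Rightarrow> real) \<Rightarrow> bool" where
  "test_fun \<Omega> \<phi> \<longleftrightarrow> (\<forall>k. C_k k \<phi>) \<and>
     compact (closure {x. \<phi> x \<noteq> 0}) \<and> closure {x. \<phi> x \<noteq> 0} \<subseteq> \<Omega>"

definition has_weak_deriv :: "(real^'n) set \<Rightarrow> 'n \<Rightarrow> (real^'n) l2 \<Rightarrow> (real^'n) l2 \<Rightarrow> bool" where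
  "has_weak_deriv \<Omega> i f g \<longleftrightarrow> g \<in> L2 \<Omega> \<and>
     (\<forall>\<phi>. test_fun \<Omega> \<phi> \<longrightarrow>
        (LINT x:\<Omega>|lborel. rep_l2 f x * frechet_derivative \<phi> (at x) (axis i 1)) =
        - (LINT x:\<Omega>|lborel. rep_l2 g x * \<phi> x))"

definition weak_deriv :: "(real^'n) set \<Rightarrow> 'n \<Rightarrow> (real^'n) l2 \<Rightarrow> (real^'n) l2" where
  "weak_deriv \<Omega> i f = (THE g. has_weak_deriv \<Omega> i f g)"

definition weak_grad :: "(real^'n) set \<Rightarrow> (real^'n) l2 \<Rightarrow> real^'n \<Rightarrow> real^'n" where
  "weak_grad \<Omega> f x = (\<chi> i. rep_l2 (weak_deriv \<Omega> i f) x)"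

definition H1 :: "(real^'n) set \<Rightarrow> (real^'n) l2 set" where
  "H1 \<Omega> = {f \<in> L2 \<Omega>. \<forall>i. \<exists>g. has_weak_deriv \<Omega> i f g}"

definition H1_norm :: "(real^'n) set \<Rightarrow> (real^'n) l2 \<Rightarrow> real" where
  "H1_norm \<Omega> f = sqrt ((norm f)\<^sup>2 + (\<Sum>i\<in>UNIV. (norm (weak_deriv \<Omega> i f))\<^sup>2))"

text \<open>\<open>H1_0 \<Omega>\<close> is the closure of the test functions in \<open>H1 \<Omega>\<close>.\<close>

definition H1_0 :: "(real^'n) set \<Rightarrow> (real^'n) l2 set" where
  "H1_0 \<Omega> = {f \<in> H1 \<Omega>. \<exists>\<phi>::nat \<Rightarrow> real^'n \<Rightarrow> real. (\<forall>k. test_fun \<Omega> (\<phi> k)) \<and>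
     (\<lambda>k. H1_norm \<Omega> (f - abs_l2 (\<phi> k))) \<longlonglongrightarrow> 0}"

text \<open>
  \<open>W1inf a b y\<close> says that \<open>y\<close> belongs to the Bochner--Sobolev space \<open>W\<^sup>1\<^sup>,\<^sup>\<infinity>(a, b; X)\<close>, where \<open>X\<close> is
  the type of the values of \<open>y\<close>; the integrals are Bochner integrals.
\<close>

definition W1inf :: "real \<Rightarrow> real \<Rightarrow> (real \<Rightarrow> 'b::{banach, second_countable_topology}) \<Rightarrow> bool" where
  "W1inf a b y \<longleftrightarrow> Linf {a<..<b} y \<and>
     (\<exists>y'. Linf {a<..<b} y' \<and>
        (\<forall>\<phi>. test_fun {a<..<b} \<phi> \<longrightarrow>
           (LINT s:{a<..<b}|lborel. deriv \<phi> s *\<^sub>R y s) = - (LINT s:{a<..<b}|lborel. \<phi> s *\<^sub>R y' s)))"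


section \<open>Domains and elliptic operators\<close>

text \<open>
  Near each boundary point, \<open>\<Omega>\<close> is the part of a ball lying above a Lipschitz graph over the
  hyperplane orthogonal to a unit vector \<open>\<nu>\<close>. In dimension one the hyperplane is a point.
\<close>

definition lipschitz_boundary :: "(real^'n) set \<Rightarrow> bool" where
  "lipschitz_boundary \<Omega> \<longleftrightarrow> (\<forall>p\<in>frontier \<Omega>. \<exists>\<nu> \<gamma> C. \<exists>\<rho>>0.
     norm \<nu> = 1 \<and> C-lipschitz_on {y. y \<bullet> \<nu> = 0} (\<gamma> :: real^'n \<Rightarrow> real) \<and>
     \<Omega> \<inter> ball p \<rho> = {x \<in> ball p \<rho>. x \<bullet> \<nu> > \<gamma> (x - (x \<bullet> \<nu>) *\<^sub>R \<nu>)})"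

definition bounded_lipschitz_domain :: "(real^'n) set \<Rightarrow> bool" where
  "bounded_lipschitz_domain \<Omega> \<longleftrightarrow>
     open \<Omega> \<and> connected \<Omega> \<and> \<Omega> \<noteq> {} \<and> bounded \<Omega> \<and> lipschitz_boundary \<Omega>"

text \<open>
  The operator \<open>\<L> r = - div (A \<nabla>r) + b \<cdot> \<nabla>r + c r\<close> with bounded measurable coefficients on \<open>\<Omega>\<close>,
  uniformly elliptic; \<open>A\<close> need not be symmetric.
\<close>

definition elliptic ::
  "(real^'n) set \<Rightarrow> (real^'n \<Rightarrow> real^'n^'n) \<Rightarrow> (real^'n \<Rightarrow> real^'n) \<Rightarrow> (real^'n \<Rightarrow> real) \<Rightarrow> bool" where
  "elliptic \<Omega> A b c \<longleftrightarrow> Linf \<Omega> A \<and> Linf \<Omega> b \<and> Linf \<Omega> c \<and>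
     (\<exists>\<theta>>0. AE x in lborel. x \<in> \<Omega> \<longrightarrow> (\<forall>\<xi>. (A x *v \<xi>) \<bullet> \<xi> \<ge> \<theta> * (norm \<xi>)\<^sup>2))"

text \<open>
  For \<open>r\<close> in \<open>H1_0 \<Omega>\<close>, \<open>\<L> r\<close> is in general only an element of the dual of \<open>H1_0 \<Omega>\<close> (a distribution);
  \<open>L_pairing \<Omega> A b c r s\<close> is the duality pairing \<open>\<langle>\<L> r, s\<rangle>\<close>, which is the \<open>L2\<close> inner product
  whenever \<open>\<L> r\<close> is in \<open>L2 \<Omega>\<close>.
\<close>

definition L_pairing ::
  "(real^'n) set \<Rightarrow> (real^'n \<Rightarrow> real^'n^'n) \<Rightarrow> (real^'n \<Rightarrow> real^'n) \<Rightarrow> (real^'n \<Rightarrow> real)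
     \<Rightarrow> (real^'n) l2 \<Rightarrow> (real^'n) l2 \<Rightarrow> real" where
  "L_pairing \<Omega> A b c r s = (LINT x:\<Omega>|lborel.
     (A x *v weak_grad \<Omega> r x) \<bullet> weak_grad \<Omega> s x
     + (b x \<bullet> weak_grad \<Omega> r x) * rep_l2 s x
     + c x * rep_l2 r x * rep_l2 s x)"


section \<open>Multiterm fractional derivatives\<close>

text \<open>
  \<open>has_frac_deriv \<alpha> y t d\<close>: the derivative \<open>D\<^sub>t\<^sup>\<alpha> y\<close> exists at \<open>t\<close> and has the value \<open>d\<close>. The values of
  \<open>y\<close> may be real numbers or elements of \<open>L2\<close>. For \<open>\<alpha> = 1\<close> it is the left derivative, which
  is the value at \<open>t\<close> of a piecewise continuous time derivative regarded as left-continuous.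
\<close>

definition has_frac_deriv ::
  "real \<Rightarrow> (real \<Rightarrow> 'b::{banach, second_countable_topology}) \<Rightarrow> real \<Rightarrow> 'b \<Rightarrow> bool" where
  "has_frac_deriv \<alpha> y t d \<longleftrightarrow>
     (if \<alpha> = 1 then (y has_vector_derivative d) (at t within {..t})
      else set_integrable lborel {0..t} (\<lambda>s. (\<alpha> * (t - s) powr (- \<alpha> - 1)) *\<^sub>R (y t - y s)) \<and>
        Gamma (1 - \<alpha>) *\<^sub>R d = t powr (- \<alpha>) *\<^sub>R (y t - y 0) +
          (LINT s:{0..t}|lborel. (\<alpha> * (t - s) powr (- \<alpha> - 1)) *\<^sub>R (y t - y s)))"

definition has_multiterm_deriv ::
  "nat \<Rightarrow> (nat \<Rightarrow> real \<Rightarrow> real) \<Rightarrow> (nat \<Rightarrow> real)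
     \<Rightarrow> (real \<Rightarrow> 'b::{banach, second_countable_topology}) \<Rightarrow> real \<Rightarrow> 'b \<Rightarrow> bool" where
  "has_multiterm_deriv l q \<alpha> y t d \<longleftrightarrow>
     (\<exists>D. (\<forall>i\<in>{1..l}. has_frac_deriv (\<alpha> i) y t (D i)) \<and> d = (\<Sum>i=1..l. q i t *\<^sub>R D i))"

text \<open>
  \<open>multiterm_inverse l q \<alpha> \<kappa> T v w\<close>: the function \<open>w\<close> is \<open>(\<Sum>\<^sub>i q\<^sub>i D\<^sub>t\<^sup>\<alpha>\<^sup>i + \<kappa>)\<^sup>-\<^sup>1 v\<close> on \<open>[0, T]\<close>. Only the
  values of \<open>v\<close> on \<open>(0, T]\<close> and of \<open>w\<close> on \<open>[0, T]\<close> matter.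
\<close>

definition multiterm_inverse ::
  "nat \<Rightarrow> (nat \<Rightarrow> real \<Rightarrow> real) \<Rightarrow> (nat \<Rightarrow> real) \<Rightarrow> real \<Rightarrow> real
     \<Rightarrow> (real \<Rightarrow> real) \<Rightarrow> (real \<Rightarrow> real) \<Rightarrow> bool" where
  "multiterm_inverse l q \<alpha> \<kappa> T v w \<longleftrightarrow>
     continuous_on {0..T} w \<and>
     (\<forall>\<epsilon> t. 0 < \<epsilon> \<and> \<epsilon> < t \<and> t \<le> T \<longrightarrow> W1inf \<epsilon> t w) \<and>
     (\<alpha> 1 = 1 \<longrightarrow> (\<exists>w'. \<forall>t\<in>{0<..T}.
        (w has_vector_derivative w' t) (at t within {..t}) \<and> (w' \<longlongrightarrow> w' t) (at_left t))) \<and>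
     w 0 = 0 \<and>
     (\<forall>t\<in>{0<..T}. \<exists>d. has_multiterm_deriv l q \<alpha> w t d \<and> d + \<kappa> * w t = v t)"


section \<open>The initial-boundary value problem\<close>

definition admissible :: "(real^'n) set \<Rightarrow> real \<Rightarrow> (real \<Rightarrow> (real^'n) l2) \<Rightarrow> bool" where
  "admissible \<Omega> T y \<longleftrightarrow>
     (\<forall>t\<in>{0..T}. y t \<in> L2 \<Omega>) \<and> continuous_on {0..T} y \<and>
     (\<forall>\<epsilon>\<in>{0<..T}. W1inf \<epsilon> T y) \<and>
     (\<forall>t\<in>{0<..T}. y t \<in> H1_0 \<Omega>)"

text \<open>
  \<open>is_residual l q \<alpha> \<Omega> A b c f y t r\<close>: at time \<open>t\<close> the distribution
  \<open>\<Sum>\<^sub>i q\<^sub>i D\<^sub>t\<^sup>\<alpha>\<^sup>i y + \<L> y - f\<close> on \<open>\<Omega>\<close> is the function \<open>r\<close> in \<open>L2 \<Omega>\<close>.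
\<close>

definition is_residual ::
  "nat \<Rightarrow> (nat \<Rightarrow> real \<Rightarrow> real) \<Rightarrow> (nat \<Rightarrow> real)
     \<Rightarrow> (real^'n) set \<Rightarrow> (real^'n \<Rightarrow> real^'n^'n) \<Rightarrow> (real^'n \<Rightarrow> real^'n) \<Rightarrow> (real^'n \<Rightarrow> real)
     \<Rightarrow> (real^'n \<Rightarrow> real \<Rightarrow> real) \<Rightarrow> (real \<Rightarrow> (real^'n) l2) \<Rightarrow> real \<Rightarrow> (real^'n) l2 \<Rightarrow> bool" where
  "is_residual l q \<alpha> \<Omega> A b c f y t r \<longleftrightarrow> r \<in> L2 \<Omega> \<and>
     (\<exists>d. has_multiterm_deriv l q \<alpha> y t d \<and>
        (\<forall>\<phi>. test_fun \<Omega> \<phi> \<longrightarrow>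
           d \<bullet> abs_l2 \<phi> + L_pairing \<Omega> A b c (y t) (abs_l2 \<phi>) - (LINT x:\<Omega>|lborel. f x t * \<phi> x)
             = r \<bullet> abs_l2 \<phi>))"

text \<open>The boundary condition \<open>u = 0\<close> is contained in the membership in \<open>H1_0 \<Omega>\<close>.\<close>

definition is_solution ::
  "nat \<Rightarrow> (nat \<Rightarrow> real \<Rightarrow> real) \<Rightarrow> (nat \<Rightarrow> real)
     \<Rightarrow> (real^'n) set \<Rightarrow> (real^'n \<Rightarrow> real^'n^'n) \<Rightarrow> (real^'n \<Rightarrow> real^'n) \<Rightarrow> (real^'n \<Rightarrow> real)
     \<Rightarrow> (real^'n \<Rightarrow> real \<Rightarrow> real) \<Rightarrow> real \<Rightarrow> (real^'n) l2 \<Rightarrow> (real \<Rightarrow> (real^'n) l2) \<Rightarrow> bool" where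
  "is_solution l q \<alpha> \<Omega> A b c f T u0 u \<longleftrightarrow>
     admissible \<Omega> T u \<and> u 0 = u0 \<and>
     (\<forall>t\<in>{0<..T}. is_residual l q \<alpha> \<Omega> A b c f u t 0)"

end

theory Submission
  imports Defs
begin

text \<open>
  Put \<open>e = uh - u\<close>. Subtracting the two weak formulations gives
  \<open>\<langle>\<Sum>\<^sub>i q\<^sub>i D\<^sup>\<alpha>\<^sup>i e, \<phi>\<rangle> + \<langle>\<L> e, \<phi>\<rangle> = \<langle>R, \<phi>\<rangle>\<close> for every test function \<open>\<phi>\<close>, and by density one may take
  \<open>\<phi> = e(t)\<close>. Coercivity and the Cauchy--Schwarz inequality then yield
  \<open>\<langle>\<Sum>\<^sub>i q\<^sub>i D\<^sup>\<alpha>\<^sup>i e, e\<rangle> + lam \<parallel>e\<parallel>\<^sup>2 \<le> \<parallel>R\<parallel> \<parallel>e\<parallel>\<close>. The kernel of every fractional derivative is nonnegative, and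
  \<open>\<langle>e(t) - e(s), e(t)\<rangle> \<ge> (\<parallel>e(t)\<parallel> - \<parallel>e(s)\<parallel>) \<parallel>e(t)\<parallel>\<close>; hence \<open>\<langle>D\<^sup>\<alpha> e, e\<rangle> \<ge> \<parallel>e\<parallel> D\<^sup>\<alpha> \<parallel>e\<parallel>\<close> wherever \<open>e \<noteq> 0\<close>
  (\<open>has_multiterm_deriv_norm\<close>), and dividing by \<open>\<parallel>e\<parallel>\<close> shows that the scalar function \<open>\<parallel>e\<parallel>\<close> satisfies
  \<open>\<Sum>\<^sub>i q\<^sub>i D\<^sup>\<alpha>\<^sup>i \<parallel>e\<parallel> + lam \<parallel>e\<parallel> \<le> \<parallel>R\<parallel>\<close> at all such times, whereas \<open>w\<close> satisfies the same relation with equality.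

  The conclusion is a maximum principle for \<open>\<Sum>\<^sub>i q\<^sub>i D\<^sup>\<alpha>\<^sup>i + lam\<close> (\<open>multiterm_comparison\<close>), which asks for
  the differential inequality only at times at which the function is positive. It is used twice:
  for \<open>- w\<close>, giving \<open>w \<ge> 0\<close>, and for \<open>\<parallel>e\<parallel> - w\<close>, where the first application guarantees that
  \<open>e(t) \<noteq> 0\<close> at every time \<open>t\<close> at which \<open>\<parallel>e\<parallel> - w\<close> is positive.

  Inserting \<open>\<phi> = e(t)\<close> rests on the linearity of the weak derivative. Since \<^const>\<open>weak_deriv\<close>
  is defined by a definite description, this amounts to uniqueness, that is, to the fundamental lemma of
  the calculus of variations (\<open>L2_eq_0_if_orthogonal_to_test_funs\<close>). It also requires that the
  weak derivatives of test functions are their classical ones, which is integration by parts.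
\<close>

section \<open>Fractional derivatives of differences and norms\<close>

lemma has_frac_deriv_diff:
  fixes y z :: "real \<Rightarrow> 'b::{banach, second_countable_topology}"
  assumes "has_frac_deriv \<alpha> y t c" "has_frac_deriv \<alpha> z t d"
  shows "has_frac_deriv \<alpha> (\<lambda>t. y t - z t) t (c - d)"
proof (cases "\<alpha> = 1")
  case True
  then show ?thesis
    using assms by (simp add: has_frac_deriv_def has_vector_derivative_diff)
next
  case False
  let ?k = "\<lambda>s. \<alpha> * (t - s) powr (- \<alpha> - 1)"
  have eq: "(\<lambda>s. ?k s *\<^sub>R (y t - z t - (y s - z s))) = (\<lambda>s. ?k s *\<^sub>R (y t - y s) - ?k s *\<^sub>R (z t - z s))"
    by (simp add: algebra_simps)
  have "set_integrable lborel {0..t} (\<lambda>s. ?k s *\<^sub>R (y t - y s))"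
      "set_integrable lborel {0..t} (\<lambda>s. ?k s *\<^sub>R (z t - z s))"
    using assms False by (simp_all add: has_frac_deriv_def)
  note int = set_integral_diff[OF this]
  let ?I = "\<lambda>y. LINT s:{0..t}|lborel. ?k s *\<^sub>R (y t - y s)"
  have "Gamma (1 - \<alpha>) *\<^sub>R (c - d) = (t powr (- \<alpha>) *\<^sub>R (y t - y 0) + ?I y) - (t powr (- \<alpha>) *\<^sub>R (z t - z 0) + ?I z)"
    using assms False by (simp add: has_frac_deriv_def scaleR_diff_right[of "Gamma (1 - \<alpha>)"])
  moreover have "(r *\<^sub>R (a - b) + I) - (r *\<^sub>R (a' - b') + J) = r *\<^sub>R (a - a' - (b - b')) + (I - J)"
    for r :: real and a a' b b' I J :: 'b
    by (simp add: algebra_simps)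
  ultimately have "Gamma (1 - \<alpha>) *\<^sub>R (c - d)
      = t powr (- \<alpha>) *\<^sub>R (y t - z t - (y 0 - z 0)) + (?I y - ?I z)"
    by simp
  then show ?thesis
    using False int unfolding has_frac_deriv_def eq by simp
qed

lemma has_multiterm_deriv_diff:
  assumes "has_multiterm_deriv l q \<alpha> y t c" "has_multiterm_deriv l q \<alpha> z t d"
  shows "has_multiterm_deriv l q \<alpha> (\<lambda>t. y t - z t) t (c - d)"
proof -
  obtain C D where
    "\<forall>i\<in>{1..l}. has_frac_deriv (\<alpha> i) y t (C i)" "c = (\<Sum>i=1..l. q i t *\<^sub>R C i)"
    "\<forall>i\<in>{1..l}. has_frac_deriv (\<alpha> i) z t (D i)" "d = (\<Sum>i=1..l. q i t *\<^sub>R D i)"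
    using assms by (auto simp: has_multiterm_deriv_def)
  then show ?thesis
    unfolding has_multiterm_deriv_def
    by (intro exI[of _ "\<lambda>i. C i - D i"])
      (auto intro: has_frac_deriv_diff simp: sum_subtractf scaleR_diff_right)
qed

lemma has_multiterm_deriv_0: "has_multiterm_deriv l q \<alpha> (\<lambda>_. 0) t 0"
  unfolding has_multiterm_deriv_def has_frac_deriv_def
  by (intro exI[of _ "\<lambda>_. 0"]) (simp add: set_integrable_def set_lebesgue_integral_def)

text \<open>
  By Cauchy--Schwarz, \<open>(\<parallel>y(t)\<parallel> - \<parallel>y(s)\<parallel>) \<parallel>y(t)\<parallel> \<le> \<langle>y(t) - y(s), y(t)\<rangle>\<close>. For \<open>\<alpha> < 1\<close> the derivative is an
  integral of such increments, together with the one for \<open>s = 0\<close>, against nonnegative weights, so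
  that the inequality is inherited; the reverse triangle inequality gives integrability. For \<open>\<alpha> = 1\<close>
  it is the chain rule, with equality, which needs \<open>y(t) \<noteq> 0\<close>.
\<close>

lemma has_frac_deriv_norm:
  fixes y :: "real \<Rightarrow> 'b::{real_inner, banach, second_countable_topology}"
  assumes y: "has_frac_deriv \<alpha> y t d" and \<alpha>: "0 < \<alpha>" "\<alpha> \<le> 1" and nz: "y t \<noteq> 0"
  shows "\<exists>D. has_frac_deriv \<alpha> (\<lambda>t. norm (y t)) t D \<and> D * norm (y t) \<le> d \<bullet> y t"
proof (cases "\<alpha> = 1")
  case True
  have y': "(y has_derivative (\<lambda>h. h *\<^sub>R d)) (at t within {..t})"
    using y True by (simp add: has_frac_deriv_def has_vector_derivative_def)
  have "((\<lambda>t. norm (y t)) has_derivative (\<lambda>h. (h *\<^sub>R d) \<bullet> sgn (y t))) (at t within {..t})"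
    using has_derivative_compose[OF y' has_derivative_norm[OF nz]] by simp
  then have "((\<lambda>t. norm (y t)) has_vector_derivative (d \<bullet> sgn (y t))) (at t within {..t})"
    by (simp add: has_vector_derivative_def)
  moreover have "d \<bullet> sgn (y t) * norm (y t) = d \<bullet> y t"
    using nz by (simp add: sgn_div_norm)
  ultimately show ?thesis using True by (auto simp: has_frac_deriv_def)
next
  case False
  let ?k = "\<lambda>s. \<alpha> * (t - s) powr (- \<alpha> - 1)"
  let ?n = "\<lambda>s. norm (y s)"
  define D where "D = (t powr (- \<alpha>) * (?n t - ?n 0) + (LINT s:{0..t}|lborel. ?k s * (?n t - ?n s))) / Gamma (1 - \<alpha>)"
  have Gamma_pos: "Gamma (1 - \<alpha>) > 0" using \<alpha> False by (intro Gamma_real_pos) auto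
  have k: "?k s \<ge> 0" for s using \<alpha> by simp
  have int: "set_integrable lborel {0..t} (\<lambda>s. ?k s *\<^sub>R (y t - y s))"
    and eq: "Gamma (1 - \<alpha>) *\<^sub>R d = t powr (- \<alpha>) *\<^sub>R (y t - y 0) + (LINT s:{0..t}|lborel. ?k s *\<^sub>R (y t - y s))"
    using y False by (simp_all add: has_frac_deriv_def)
  have CS: "?n t * (?n t - ?n s) \<le> (y t - y s) \<bullet> y t" for s
    using norm_cauchy_schwarz[of "y s" "y t"]
    by (simp add: inner_diff_left dot_square_norm power2_eq_square algebra_simps)
  have int_n: "set_integrable lborel {0..t} (\<lambda>s. ?k s * (?n t - ?n s))"
  proof (rule set_integrable_bound[OF int])
    let ?G = "\<lambda>s. indicator {0..t} s *\<^sub>R (?k s *\<^sub>R (y t - y s))"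
    \<comment> \<open>Only the weighted function \<open>?G\<close> is known to be measurable. As the weight is positive on
      \<open>[0, t)\<close>, dividing by it recovers \<open>y\<close> there; at \<open>t\<close> the increment vanishes.\<close>
    have [measurable]: "?G \<in> borel_measurable lborel"
      using int unfolding set_integrable_def by (rule borel_measurable_integrable)
    have "(\<lambda>s. ?k s * (indicator {0..<t} s *\<^sub>R (?n t - norm (y t - (1 / ?k s) *\<^sub>R ?G s))))
        \<in> borel_measurable lborel"
      by measurable
    also have "?this \<longleftrightarrow> set_borel_measurable lborel {0..t} (\<lambda>s. ?k s * (?n t - ?n s))"
      unfolding set_borel_measurable_def
    proof (rule measurable_cong)
      fix s
      show "?k s * (indicator {0..<t} s *\<^sub>R (?n t - norm (y t - (1 / ?k s) *\<^sub>R ?G s)))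
        = indicator {0..t} s *\<^sub>R (?k s * (?n t - ?n s))"
      proof (cases "s \<in> {0..<t}")
        case True
        then have "?k s \<noteq> 0" using \<alpha> by simp
        with True show ?thesis by simp
      next
        case False
        then show ?thesis by (auto simp: indicator_def)
      qed
    qed
    finally show "set_borel_measurable lborel {0..t} (\<lambda>s. ?k s * (?n t - ?n s))" .
    show "AE s in lborel. s \<in> {0..t} \<longrightarrow> norm (?k s * (?n t - ?n s)) \<le> norm (?k s *\<^sub>R (y t - y s))"
      using k by (intro AE_I2) (auto simp: abs_mult intro!: mult_left_mono norm_triangle_ineq3)
  qed
  have "D * Gamma (1 - \<alpha>) * ?n t
      = t powr (- \<alpha>) * (?n t * (?n t - ?n 0)) + (LINT s:{0..t}|lborel. ?n t * (?k s * (?n t - ?n s)))"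
  proof -
    have "D * Gamma (1 - \<alpha>) = t powr (- \<alpha>) * (?n t - ?n 0) + (LINT s:{0..t}|lborel. ?k s * (?n t - ?n s))"
      using Gamma_pos by (simp add: D_def)
    moreover have "(LINT s:{0..t}|lborel. ?n t * (?k s * (?n t - ?n s))) = ?n t * (LINT s:{0..t}|lborel. ?k s * (?n t - ?n s))"
      by (rule set_integral_mult_right)
    ultimately show ?thesis by (simp only: distrib_left mult_ac)
  qed
  also have "\<dots> \<le> t powr (- \<alpha>) * ((y t - y 0) \<bullet> y t) + (LINT s:{0..t}|lborel. (?k s *\<^sub>R (y t - y s)) \<bullet> y t)"
  proof (intro add_mono mult_left_mono CS set_integral_mono)
    show "set_integrable lborel {0..t} (\<lambda>s. ?n t * (?k s * (?n t - ?n s)))"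
      using int_n by (rule set_integrable_mult_right)
    show "set_integrable lborel {0..t} (\<lambda>s. (?k s *\<^sub>R (y t - y s)) \<bullet> y t)"
      using integrable_inner_left[of "y t" lborel "\<lambda>s. indicator {0..t} s *\<^sub>R (?k s *\<^sub>R (y t - y s))"] int
      by (simp add: set_integrable_def mult.assoc)
    show "?n t * (?k s * (?n t - ?n s)) \<le> (?k s *\<^sub>R (y t - y s)) \<bullet> y t" for s
      using mult_left_mono[OF CS[of s] k[of s]] by (simp add: mult_ac)
  qed auto
  also have "(LINT s:{0..t}|lborel. (?k s *\<^sub>R (y t - y s)) \<bullet> y t)
      = (LINT s:{0..t}|lborel. ?k s *\<^sub>R (y t - y s)) \<bullet> y t"
  proof -
    have "(LINT s:S|lborel. g s \<bullet> v) = (LINT s:S|lborel. g s) \<bullet> v"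
      if "set_integrable lborel S g" for S and g :: "real \<Rightarrow> 'b" and v
      using that integral_inner_left[of v lborel "\<lambda>s. indicator S s *\<^sub>R g s"]
      by (simp add: set_integrable_def set_lebesgue_integral_def)
    from this[OF int] show ?thesis .
  qed
  also have "t powr (- \<alpha>) * ((y t - y 0) \<bullet> y t) + \<dots> = Gamma (1 - \<alpha>) * (d \<bullet> y t)"
    using arg_cong[OF eq, of "\<lambda>v. v \<bullet> y t"] by (simp add: inner_add_left)
  finally have "D * ?n t \<le> d \<bullet> y t"
    using Gamma_pos by (simp add: mult.commute[of D] mult.assoc)
  moreover have "has_frac_deriv \<alpha> (\<lambda>t. norm (y t)) t D"
    using False int_n Gamma_pos by (simp add: has_frac_deriv_def D_def)
  ultimately show ?thesis by blast
qed

lemma has_multiterm_deriv_norm: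
  fixes y :: "real \<Rightarrow> 'b::{real_inner, banach, second_countable_topology}"
  assumes y: "has_multiterm_deriv l q \<alpha> y t d"
    and \<alpha>: "\<forall>i\<in>{1..l}. 0 < \<alpha> i \<and> \<alpha> i \<le> 1" and q: "\<forall>i\<in>{1..l}. q i t \<ge> 0" and nz: "y t \<noteq> 0"
  shows "\<exists>D. has_multiterm_deriv l q \<alpha> (\<lambda>t. norm (y t)) t D \<and> D * norm (y t) \<le> d \<bullet> y t"
proof -
  obtain d' where d': "\<forall>i\<in>{1..l}. has_frac_deriv (\<alpha> i) y t (d' i)" "d = (\<Sum>i=1..l. q i t *\<^sub>R d' i)"
    using y by (auto simp: has_multiterm_deriv_def)
  then have "\<forall>i\<in>{1..l}. \<exists>D. has_frac_deriv (\<alpha> i) (\<lambda>t. norm (y t)) t D \<and> D * norm (y t) \<le> d' i \<bullet> y t"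
    using \<alpha> nz by (auto intro: has_frac_deriv_norm)
  then obtain D where D: "\<And>i. i \<in> {1..l} \<Longrightarrow> has_frac_deriv (\<alpha> i) (\<lambda>t. norm (y t)) t (D i)"
      "\<And>i. i \<in> {1..l} \<Longrightarrow> D i * norm (y t) \<le> d' i \<bullet> y t"
    by metis
  have "(\<Sum>i=1..l. q i t *\<^sub>R D i) * norm (y t) = (\<Sum>i=1..l. q i t * (D i * norm (y t)))"
    by (simp add: sum_distrib_right mult.assoc)
  also have "\<dots> \<le> (\<Sum>i=1..l. q i t * (d' i \<bullet> y t))"
    using q D(2) by (intro sum_mono mult_left_mono) auto
  also have "\<dots> = d \<bullet> y t"
    by (simp add: d'(2) inner_sum_left)
  finally show ?thesis
    using D(1) unfolding has_multiterm_deriv_def by blast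
qed

section \<open>A comparison principle\<close>

text \<open>
  For \<open>\<alpha> < 1\<close> all increments in the defining formula are nonnegative, and the one between \<open>0\<close> and \<open>t\<close> is
  positive. For \<open>\<alpha> = 1\<close> the left derivative at a mere maximum could vanish; here it is at least \<open>\<epsilon>\<close>. The
  hypothesis says that \<open>z(s) - \<epsilon> s\<close> is maximal over \<open>[0, t]\<close> at \<open>t\<close>.
\<close>

lemma has_frac_deriv_pos_if_steep_max:
  fixes z :: "real \<Rightarrow> real"
  assumes z: "has_frac_deriv \<alpha> z t d" and \<alpha>: "0 < \<alpha>" "\<alpha> \<le> 1" and t: "t > 0"
    and \<epsilon>: "\<epsilon> > 0" "\<And>s. s \<in> {0..t} \<Longrightarrow> z t - z s \<ge> \<epsilon> * (t - s)"
  shows "d > 0"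
proof (cases "\<alpha> = 1")
  case True
  then have "(z has_real_derivative d) (at t within {..t})"
    using z by (simp add: has_frac_deriv_def has_real_derivative_iff_has_vector_derivative)
  then have lim: "((\<lambda>s. (z s - z t) / (s - t)) \<longlongrightarrow> d) (at t within {..t})"
    by (simp add: has_field_derivative_iff)
  have "\<forall>\<^sub>F s in at t within {..t}. s \<in> {0<..}"
    unfolding eventually_at_filter
    by (rule eventually_mono[OF eventually_nhds_in_open[of "{0<..}" t]]) (use t in auto)
  moreover have "\<forall>\<^sub>F s in at t within {..t}. s < t"
    by (auto simp: eventually_at_filter intro!: always_eventually)
  ultimately have "\<forall>\<^sub>F s in at t within {..t}. \<epsilon> \<le> (z s - z t) / (s - t)"
  proof eventually_elim
    case (elim s)
    then have "z t - z s \<ge> \<epsilon> * (t - s)" by (intro \<epsilon>) auto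
    with elim show ?case by (simp add: neg_le_divide_eq algebra_simps)
  qed
  moreover have "at t within {..t} \<noteq> bot"
    using trivial_limit_at_left_real[of t] at_within_Iic_at_left by metis
  ultimately have "\<epsilon> \<le> d" using tendsto_lowerbound[OF lim] by blast
  then show ?thesis using \<epsilon> by simp
next
  case False
  then have "Gamma (1 - \<alpha>) * d = t powr (- \<alpha>) * (z t - z 0)
      + (LINT s:{0..t}|lborel. (\<alpha> * (t - s) powr (- \<alpha> - 1)) * (z t - z s))"
    using z by (simp add: has_frac_deriv_def)
  moreover have "t powr (- \<alpha>) * (z t - z 0) > 0"
  proof -
    have "0 < \<epsilon> * (t - 0)" using \<epsilon> t by simp
    also have "\<dots> \<le> z t - z 0" using t by (intro \<epsilon>) auto
    finally show ?thesis using t by simp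
  qed
  moreover have "(LINT s:{0..t}|lborel. (\<alpha> * (t - s) powr (- \<alpha> - 1)) * (z t - z s)) \<ge> 0"
    unfolding set_lebesgue_integral_def
  proof (rule Bochner_Integration.integral_nonneg)
    fix s
    show "0 \<le> indicator {0..t} s *\<^sub>R (\<alpha> * (t - s) powr (- \<alpha> - 1) * (z t - z s))"
    proof (cases "s \<in> {0..t}")
      case True
      have "0 \<le> \<epsilon> * (t - s)" using \<epsilon> True by simp
      also have "\<dots> \<le> z t - z s" using True by (rule \<epsilon>)
      finally show ?thesis using \<alpha> by simp
    qed simp
  qed
  ultimately have "Gamma (1 - \<alpha>) * d > 0" by simp
  moreover have "Gamma (1 - \<alpha>) > 0" using \<alpha> False by (intro Gamma_real_pos) auto
  ultimately show ?thesis by (simp add: zero_less_mult_iff)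
qed

text \<open>
  Were \<open>z\<close> positive somewhere, then for small \<open>\<epsilon> > 0\<close> the function \<open>z(s) - \<epsilon> s\<close> would have a positive
  maximum, attained at some \<open>m > 0\<close>. There every \<open>D\<^sup>\<alpha>\<^sup>i z\<close> is positive, and so is some \<open>q\<^sub>i(m)\<close>, which
  contradicts the differential inequality at \<open>m\<close>.
\<close>

lemma multiterm_comparison:
  fixes z :: "real \<Rightarrow> real"
  assumes \<alpha>: "\<forall>i\<in>{1..l}. 0 < \<alpha> i \<and> \<alpha> i \<le> 1"
    and q: "\<forall>i\<in>{1..l}. \<forall>t\<in>{0..T}. q i t \<ge> 0" "\<forall>t\<in>{0..T}. (\<Sum>i=1..l. q i t) > 0"
    and lam: "lam \<ge> 0"
    and z: "continuous_on {0..T} z" "z 0 \<le> 0"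
    and sub: "\<And>t. t \<in> {0<..T} \<Longrightarrow> z t > 0 \<Longrightarrow>
      \<exists>d. has_multiterm_deriv l q \<alpha> z t d \<and> d + lam * z t \<le> 0"
    and t: "t \<in> {0..T}"
  shows "z t \<le> 0"
proof (rule ccontr)
  assume "\<not> z t \<le> 0"
  then have zt: "z t > 0" by simp
  then have "t \<noteq> 0" using z(2) by auto
  then have t0: "t > 0" using t by simp
  \<comment> \<open>Half the slope that makes the tilted value at \<open>t\<close> vanish: \<open>z(t) - \<epsilon> t = z(t) / 2\<close> is still positive.\<close>
  define \<epsilon> where "\<epsilon> = z t / (2 * t)"
  have \<epsilon>: "\<epsilon> > 0" using zt t0 by (simp add: \<epsilon>_def)
  have "continuous_on {0..T} (\<lambda>s. z s - \<epsilon> * s)" by (intro continuous_intros z)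
  then obtain m where m: "m \<in> {0..T}" "\<And>s. s \<in> {0..T} \<Longrightarrow> z s - \<epsilon> * s \<le> z m - \<epsilon> * m"
    using continuous_attains_sup[of "{0..T}" "\<lambda>s. z s - \<epsilon> * s"] t by auto
  have "z t - \<epsilon> * t > 0" using zt t0 by (simp add: \<epsilon>_def)
  also have "z t - \<epsilon> * t \<le> z m - \<epsilon> * m" using t by (rule m(2))
  finally have pos: "z m - \<epsilon> * m > 0" .
  moreover have "\<epsilon> * m \<ge> 0" using \<epsilon> m by simp
  ultimately have zm: "z m > 0" by linarith
  then have "m \<noteq> 0" using z(2) by auto
  then have m0: "m \<in> {0<..T}" using m(1) by simp
  obtain D where D: "\<forall>i\<in>{1..l}. has_frac_deriv (\<alpha> i) z m (D i)"
      "(\<Sum>i=1..l. q i m *\<^sub>R D i) + lam * z m \<le> 0"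
    using sub[OF m0 zm] by (auto simp: has_multiterm_deriv_def)
  have Dpos: "D i > 0" if "i \<in> {1..l}" for i
  proof (rule has_frac_deriv_pos_if_steep_max[of "\<alpha> i" z m "D i" \<epsilon>])
    fix s assume "s \<in> {0..m}"
    then have "z s - \<epsilon> * s \<le> z m - \<epsilon> * m" using m by auto
    then show "\<epsilon> * (m - s) \<le> z m - z s" by (simp add: algebra_simps)
  qed (use that D \<alpha> m0 \<epsilon> in auto)
  have nonneg: "q i m * D i \<ge> 0" if "i \<in> {1..l}" for i
    using Dpos[OF that] q(1) m(1) that by (intro mult_nonneg_nonneg) auto
  obtain j where j: "j \<in> {1..l}" "q j m > 0"
  proof -
    have "(\<Sum>i=1..l. q i m) > 0" using q(2) m(1) by blast
    then show thesis using that by (metis sum_nonpos not_less)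
  qed
  have "0 < (\<Sum>i=1..l. q i m *\<^sub>R D i)"
    using j nonneg Dpos[OF j(1)] by (intro sum_pos2[of _ j]) auto
  moreover have "lam * z m \<ge> 0" using lam zm by simp
  ultimately show False using D(2) by linarith
qed

section \<open>Smooth bump functions on boxes\<close>

text \<open>
  The classical flat function \<open>exp (-1/x)\<close>, extended by \<open>0\<close>, with a polynomial factor in \<open>1/x\<close>: this
  family is closed under differentiation, so a single computation of a derivative shows that all of its
  members are smooth.
\<close>

definition flat :: "real poly \<Rightarrow> real \<Rightarrow> real" where
  "flat p x = (if x > 0 then poly p (1 / x) * exp (- (1 / x)) else 0)"

lemma poly_times_exp_decay:
  fixes p :: "real poly"
  shows "((\<lambda>u. poly p u * exp (- u)) \<longlongrightarrow> 0) at_top"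
proof -
  have "((\<lambda>u. \<Sum>i\<le>degree p. coeff p i * (u ^ i / exp u)) \<longlongrightarrow> (\<Sum>i\<le>degree p. coeff p i * 0)) at_top"
    by (intro tendsto_sum tendsto_mult tendsto_const tendsto_power_div_exp_0)
  then show ?thesis
    by (simp add: poly_altdef exp_minus divide_inverse sum_distrib_right mult.assoc)
qed

lemma flat_tendsto_0: "(flat p \<longlongrightarrow> 0) (at 0)"
proof (rule filterlim_split_at)
  show "(flat p \<longlongrightarrow> 0) (at_left 0)"
    by (rule tendsto_eventually) (auto simp: flat_def eventually_at_filter)
  have "((\<lambda>x. poly p (1 / x) * exp (- (1 / x))) \<longlongrightarrow> 0) (at_right 0)"
    using filterlim_compose[OF poly_times_exp_decay[of p] filterlim_inverse_at_top_right]
    by (simp add: inverse_eq_divide)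
  then show "(flat p \<longlongrightarrow> 0) (at_right 0)"
    by (rule Lim_transform_eventually) (auto simp: flat_def eventually_at_filter)
qed

lemma DERIV_flat:
  "(flat p has_real_derivative flat (monom 1 2 * (p - pderiv p)) x) (at x)"
proof -
  consider "x > 0" | "x < 0" | "x = 0" by linarith
  then show ?thesis
  proof cases
    case 1
    have "((\<lambda>x. poly p (1 / x) * exp (- (1 / x))) has_real_derivative
        flat (monom 1 2 * (p - pderiv p)) x) (at x)"
      using 1 by (auto intro!: derivative_eq_intros DERIV_chain2[OF poly_DERIV]
          simp: flat_def poly_monom field_simps power2_eq_square)
    then show ?thesis
      by (rule has_field_derivative_transform_within_open[of _ _ _ "{0<..}"])
        (use 1 in \<open>auto simp: flat_def\<close>)
  next
    case 2
    have "((\<lambda>x. 0) has_real_derivative flat (monom 1 2 * (p - pderiv p)) x) (at x)"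
      using 2 by (simp add: flat_def)
    then show ?thesis
      by (rule has_field_derivative_transform_within_open[of _ _ _ "{..<0}"])
        (use 2 in \<open>auto simp: flat_def\<close>)
  next
    case 3
    \<comment> \<open>Multiplying the polynomial by its variable divides by the argument, so the difference quotient at \<open>0\<close> is itself flat.\<close>
    have "flat (pCons 0 p) = (\<lambda>y. (flat p y - flat p 0) / (y - 0))"
      by (simp add: flat_def fun_eq_iff)
    moreover have "flat q 0 = 0" for q by (simp add: flat_def)
    ultimately show ?thesis
      using flat_tendsto_0[of "pCons 0 p"] 3 by (simp add: has_field_derivative_iff)
  qed
qed

text \<open>
  A class of functions closed under all partial derivatives and containing the bump functions below;
  closure under derivatives makes every member satisfy \<^const>\<open>C_k\<close> for all \<open>k\<close>.
\<close>

inductive flat_algebra :: "('a::euclidean_space \<Rightarrow> real) \<Rightarrow> bool" where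
  const: "flat_algebra (\<lambda>x. c)"
| ridge: "flat_algebra (\<lambda>x. flat p (x \<bullet> v + c))"
| add: "flat_algebra \<phi> \<Longrightarrow> flat_algebra \<psi> \<Longrightarrow> flat_algebra (\<lambda>x. \<phi> x + \<psi> x)"
| mult: "flat_algebra \<phi> \<Longrightarrow> flat_algebra \<psi> \<Longrightarrow> flat_algebra (\<lambda>x. \<phi> x * \<psi> x)"

lemma flat_algebra_derivative:
  assumes "flat_algebra \<phi>"
  shows "\<exists>\<phi>'. (\<forall>x. (\<phi> has_derivative \<phi>' x) (at x)) \<and> (\<forall>u. flat_algebra (\<lambda>x. \<phi>' x u))"
  using assms
proof induction
  case (const c)
  show ?case by (intro exI[of _ "\<lambda>x u. 0"]) (auto intro: flat_algebra.intros)
next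
  case (ridge p v c)
  let ?q = "monom 1 2 * (p - pderiv p)"
  have "((\<lambda>x. flat p (x \<bullet> v + c)) has_derivative (\<lambda>u. flat ?q (x \<bullet> v + c) * (u \<bullet> v))) (at x)" for x
  proof -
    have "((\<lambda>x. x \<bullet> v + c) has_derivative (\<lambda>u. u \<bullet> v)) (at x)"
      by (auto intro!: derivative_eq_intros)
    from DERIV_compose_FDERIV[OF DERIV_flat this] show ?thesis
      by (simp add: mult.commute)
  qed
  moreover have "flat_algebra (\<lambda>x. flat ?q (x \<bullet> v + c) * (u \<bullet> v))" for u
    by (intro flat_algebra.intros)
  ultimately show ?case
    by (intro exI[of _ "\<lambda>x u. flat ?q (x \<bullet> v + c) * (u \<bullet> v)"]) blast
next
  case (add \<phi> \<psi>)
  then obtain \<phi>' \<psi>' where "\<And>x. (\<phi> has_derivative \<phi>' x) (at x)" "\<And>u. flat_algebra (\<lambda>x. \<phi>' x u)"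
      "\<And>x. (\<psi> has_derivative \<psi>' x) (at x)" "\<And>u. flat_algebra (\<lambda>x. \<psi>' x u)" by blast
  then show ?case
    by (intro exI[of _ "\<lambda>x u. \<phi>' x u + \<psi>' x u"]) (auto intro: has_derivative_add flat_algebra.intros)
next
  case (mult \<phi> \<psi>)
  then obtain \<phi>' \<psi>' where "\<And>x. (\<phi> has_derivative \<phi>' x) (at x)" "\<And>u. flat_algebra (\<lambda>x. \<phi>' x u)"
      "\<And>x. (\<psi> has_derivative \<psi>' x) (at x)" "\<And>u. flat_algebra (\<lambda>x. \<psi>' x u)" by blast
  with mult.hyps show ?case
    by (intro exI[of _ "\<lambda>x u. \<phi> x * \<psi>' x u + \<phi>' x u * \<psi> x"])
      (auto intro!: has_derivative_mult flat_algebra.add[OF flat_algebra.mult flat_algebra.mult])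
qed

lemma C_k_flat_algebra: "flat_algebra \<phi> \<Longrightarrow> C_k k \<phi>"
proof (induction k arbitrary: \<phi>)
  case 0
  then obtain \<phi>' where "\<And>x. (\<phi> has_derivative \<phi>' x) (at x)"
    using flat_algebra_derivative by blast
  then show ?case
    by (auto intro!: continuous_at_imp_continuous_on has_derivative_continuous)
next
  case (Suc k)
  obtain \<phi>' where \<phi>': "\<And>x. (\<phi> has_derivative \<phi>' x) (at x)" "\<And>u. flat_algebra (\<lambda>x. \<phi>' x u)"
    using flat_algebra_derivative[OF Suc.prems] by blast
  then have "frechet_derivative \<phi> (at x) = \<phi>' x" for x
    by (metis frechet_derivative_at)
  with \<phi>' Suc.IH show ?case
    by (auto simp: differentiable_def)
qed

lemma flat_algebra_prod:
  "(\<And>i. i \<in> I \<Longrightarrow> flat_algebra (\<phi> i)) \<Longrightarrow> flat_algebra (\<lambda>x. \<Prod>i\<in>I. \<phi> i x)"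
  by (induction I rule: infinite_finite_induct) (auto intro: flat_algebra.intros)

text \<open>
  Positive exactly on the open box. Since \<open>flat 1 (k x) = exp (-1/x) powr (1/k)\<close> for \<open>x > 0\<close>, these
  functions increase to the indicator function of the box as \<open>k\<close> grows, so no mollification is needed.
\<close>

definition box_bump :: "'a::euclidean_space \<Rightarrow> 'a \<Rightarrow> real \<Rightarrow> 'a \<Rightarrow> real" where
  "box_bump a b k x = (\<Prod>i\<in>Basis. flat 1 (k * ((x - a) \<bullet> i)) * flat 1 (k * ((b - x) \<bullet> i)))"

lemma box_bump_nonneg: "0 \<le> box_bump a b k x"
  by (auto simp: box_bump_def flat_def intro!: prod_nonneg)

lemma box_bump_le_1: "box_bump a b k x \<le> 1"
  unfolding box_bump_def by (rule prod_le_1) (auto simp: flat_def intro!: mult_le_one)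

lemma box_bump_outside:
  assumes "k > 0" "x \<notin> box a b"
  shows "box_bump a b k x = 0"
proof -
  obtain i where "i \<in> Basis" "x \<bullet> i \<le> a \<bullet> i \<or> b \<bullet> i \<le> x \<bullet> i"
    using assms(2) by (force simp: mem_box)
  then show ?thesis
    unfolding box_bump_def using assms(1)
    by (intro prod_zero) (auto intro!: bexI[of _ i] simp: flat_def inner_diff_left zero_less_mult_iff)
qed

lemma box_bump_tendsto:
  "(\<lambda>n. box_bump a b (real (Suc n)) x) \<longlonglongrightarrow> indicator (box a b) x"
proof (cases "x \<in> box a b")
  case True
  have "(\<lambda>n. flat 1 (real (Suc n) * y)) \<longlonglongrightarrow> 1" if "y > 0" for y
  proof -
    have "(\<lambda>n. exp (- (inverse (real (Suc n)) * (1 / y)))) \<longlonglongrightarrow> exp (- (0 * (1 / y)))"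
      by (intro tendsto_intros LIMSEQ_inverse_real_of_nat)
    moreover have "exp (- (inverse (real (Suc n)) * (1 / y))) = flat 1 (real (Suc n) * y)" for n
      using that by (simp add: flat_def divide_inverse zero_less_mult_iff del: of_nat_Suc)
    ultimately show ?thesis by simp
  qed
  then have "(\<lambda>n. box_bump a b (real (Suc n)) x) \<longlonglongrightarrow> (\<Prod>i\<in>(Basis::'a set). 1 * 1)"
    unfolding box_bump_def using True
    by (intro tendsto_prod tendsto_mult) (auto simp: mem_box inner_diff_left)
  then show ?thesis using True by simp
next
  case False
  then show ?thesis by (simp add: box_bump_outside)
qed

lemma test_fun_box_bump:
  assumes "cbox a b \<subseteq> \<Omega>" "k > 0"
  shows "test_fun \<Omega> (box_bump a b k)"
proof -
  have "flat_algebra (box_bump a b k)"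
  proof -
    have "flat 1 (k * ((x - a) \<bullet> i)) * flat 1 (k * ((b - x) \<bullet> i))
        = flat 1 (x \<bullet> (k *\<^sub>R i) + - k * (a \<bullet> i)) * flat 1 (x \<bullet> (- k *\<^sub>R i) + k * (b \<bullet> i))" for x i
      by (simp add: inner_diff_left algebra_simps)
    then have "box_bump a b k = (\<lambda>x. \<Prod>i\<in>Basis.
        flat 1 (x \<bullet> (k *\<^sub>R i) + - k * (a \<bullet> i)) * flat 1 (x \<bullet> (- k *\<^sub>R i) + k * (b \<bullet> i)))"
      by (simp add: box_bump_def fun_eq_iff)
    then show ?thesis
      by (simp only:) (intro flat_algebra_prod flat_algebra.intros)
  qed
  moreover have "closure {x. box_bump a b k x \<noteq> 0} \<subseteq> cbox a b"
    using box_bump_outside[OF assms(2), of _ a b] box_subset_cbox[of a b]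
    by (intro closure_minimal) auto
  ultimately show ?thesis
    using assms unfolding test_fun_def
    by (auto intro: C_k_flat_algebra bounded_subset[OF bounded_cbox order_trans[OF closure_subset]])
qed

section \<open>Test functions and integration by parts\<close>

lemma test_fun_continuous: "test_fun \<Omega> \<phi> \<Longrightarrow> continuous_on UNIV \<phi>"
  unfolding test_fun_def using C_k.simps(1) by blast

lemma test_fun_has_derivative:
  assumes "test_fun \<Omega> \<phi>"
  shows "(\<phi> has_derivative frechet_derivative \<phi> (at x)) (at x)"
proof -
  have "C_k (Suc 0) \<phi>" using assms unfolding test_fun_def by blast
  then show ?thesis by (simp add: frechet_derivative_works[symmetric])
qed

lemma test_fun_outside: "test_fun \<Omega> \<phi> \<Longrightarrow> x \<notin> \<Omega> \<Longrightarrow> \<phi> x = 0"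
  using closure_subset[of "{x. \<phi> x \<noteq> 0}"] unfolding test_fun_def by blast

lemma test_fun_bounded:
  fixes \<phi> :: "'a::euclidean_space \<Rightarrow> real"
  assumes "test_fun \<Omega> \<phi>"
  obtains C r where "C \<ge> 0" "\<And>x. \<bar>\<phi> x\<bar> \<le> C * indicator (cball 0 r) x"
proof -
  let ?K = "closure {x. \<phi> x \<noteq> 0}"
  have "compact ?K" using assms by (simp add: test_fun_def)
  then obtain r where "\<forall>x\<in>?K. norm x \<le> r"
    using compact_imp_bounded bounded_iff by blast
  then have r: "?K \<subseteq> cball 0 r" by auto
  have "compact (\<phi> ` ?K)"
    using \<open>compact ?K\<close> test_fun_continuous[OF assms]
    by (intro compact_continuous_image) (auto intro: continuous_on_subset)
  then obtain C where C: "C > 0" "\<And>x. x \<in> ?K \<Longrightarrow> \<bar>\<phi> x\<bar> \<le> C"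
    by (auto dest!: compact_imp_bounded simp: bounded_pos)
  show thesis
  proof (rule that)
    show "\<bar>\<phi> x\<bar> \<le> C * indicator (cball 0 r) x" for x
    proof (cases "\<phi> x = 0")
      case False
      then have "x \<in> ?K" using closure_subset[of "{x. \<phi> x \<noteq> 0}"] by blast
      then show ?thesis using C r by (auto simp: indicator_def)
    qed (use C in auto)
  qed (use C in auto)
qed

lemma test_fun_square_integrable:
  assumes "test_fun \<Omega> \<phi>"
  shows "square_integrable \<phi>"
proof -
  obtain C r where "\<And>x. \<bar>\<phi> x\<bar> \<le> C * indicator (cball 0 r) x"
    using test_fun_bounded[OF assms] by blast
  then show ?thesis
    using test_fun_continuous[OF assms]
    by (intro square_integrable_bounded_support borel_measurable_continuous_onI)
qed

lemma C_k_diff: "C_k k \<phi> \<Longrightarrow> C_k k \<psi> \<Longrightarrow> C_k k (\<lambda>x. \<phi> x - \<psi> x)"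
proof (induction k arbitrary: \<phi> \<psi>)
  case 0
  then show ?case by (auto intro: continuous_on_diff)
next
  case (Suc k)
  then have "frechet_derivative (\<lambda>x. \<phi> x - \<psi> x) (at x)
      = (\<lambda>h. frechet_derivative \<phi> (at x) h - frechet_derivative \<psi> (at x) h)" for x
    by (intro frechet_derivative_at[symmetric] has_derivative_diff)
      (simp_all add: frechet_derivative_works[symmetric])
  with Suc show ?case by (auto intro: differentiable_diff)
qed

lemma test_fun_diff:
  assumes "test_fun \<Omega> \<phi>" "test_fun \<Omega> \<psi>"
  shows "test_fun \<Omega> (\<lambda>x. \<phi> x - \<psi> x)"
proof -
  let ?S = "\<lambda>\<phi>. closure {x. \<phi> x \<noteq> (0::real)}"
  have sub: "?S (\<lambda>x. \<phi> x - \<psi> x) \<subseteq> ?S \<phi> \<union> ?S \<psi>"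
    unfolding closure_Un[symmetric] by (intro closure_mono) auto
  moreover have "compact (?S \<phi> \<union> ?S \<psi>)"
    using assms by (intro compact_Un) (auto simp: test_fun_def)
  ultimately have "compact (?S (\<lambda>x. \<phi> x - \<psi> x))"
    using compact_Int_closed[of "?S \<phi> \<union> ?S \<psi>" "?S (\<lambda>x. \<phi> x - \<psi> x)"] by (simp add: Int_absorb1)
  moreover have "?S (\<lambda>x. \<phi> x - \<psi> x) \<subseteq> \<Omega>"
    using sub assms unfolding test_fun_def by blast
  ultimately show ?thesis
    using assms unfolding test_fun_def by (blast intro: C_k_diff)
qed

lemma test_fun_deriv:
  assumes "test_fun \<Omega> \<phi>" "v \<in> Basis"
  shows "test_fun \<Omega> (\<lambda>x. frechet_derivative \<phi> (at x) v)"
proof -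
  let ?S = "\<lambda>\<phi>. closure {x. \<phi> x \<noteq> (0::real)}"
  have "frechet_derivative \<phi> (at x) = (\<lambda>h. 0)" if "x \<notin> ?S \<phi>" for x
  proof -
    have "((\<lambda>x. 0) has_derivative (\<lambda>h. 0)) (at x)" by simp
    then have "(\<phi> has_derivative (\<lambda>h. 0)) (at x)"
      by (rule has_derivative_transform_within_open[of _ _ _ UNIV "- ?S \<phi>", simplified])
        (use that closure_subset[of "{x. \<phi> x \<noteq> 0}"] in auto)
    then show ?thesis by (metis frechet_derivative_at)
  qed
  then have sub: "?S (\<lambda>x. frechet_derivative \<phi> (at x) v) \<subseteq> ?S \<phi>"
    by (intro closure_minimal) force+
  then have "compact (?S (\<lambda>x. frechet_derivative \<phi> (at x) v))"
    using assms(1) compact_Int_closed[of "?S \<phi>" "?S (\<lambda>x. frechet_derivative \<phi> (at x) v)"]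
    unfolding test_fun_def by (simp add: Int_absorb1)
  moreover have "C_k k (\<lambda>x. frechet_derivative \<phi> (at x) v)" for k
  proof -
    have "C_k (Suc k) \<phi>" using assms(1) unfolding test_fun_def by blast
    then show ?thesis using assms(2) by simp
  qed
  ultimately show ?thesis
    using sub assms unfolding test_fun_def by blast
qed

text \<open>
  Because \<open>\<phi>\<close> vanishes outside \<open>\<Omega>\<close>, the integrals over \<open>\<Omega>\<close> in the definition of weak derivatives
  are inner products of the Hilbert space, where linearity and continuity come for free.
\<close>

lemma integral_test_fun_eq_inner:
  assumes "test_fun \<Omega> \<phi>"
  shows "(LINT x:\<Omega>|lborel. rep_l2 f x * \<phi> x) = f \<bullet> abs_l2 \<phi>"
proof -
  have "(LINT x:\<Omega>|lborel. rep_l2 f x * \<phi> x) = (LINT x|lborel. rep_l2 f x * \<phi> x)"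
    unfolding set_lebesgue_integral_def
    using test_fun_outside[OF assms]
    by (intro Bochner_Integration.integral_cong) (auto simp: indicator_def)
  also have "\<dots> = abs_l2 (rep_l2 f) \<bullet> abs_l2 \<phi>"
    by (rule inner_abs_l2[symmetric]) (intro square_integrable_rep_l2 test_fun_square_integrable[OF assms])+
  finally show ?thesis by simp
qed

text \<open>
  The integral of the difference quotient \<open>(F(x + h v) - F(x)) / h\<close> is \<open>0\<close> by translation invariance of
  Lebesgue measure. By the mean value theorem the quotients with \<open>0 < h \<le> 1\<close> are dominated by a multiple
  of the indicator function of a ball, and dominated convergence applies.
\<close>

lemma integral_directional_derivative_eq_0:
  fixes F :: "'a::euclidean_space \<Rightarrow> real"
  assumes F': "\<And>x. (F has_derivative F' x) (at x)"
    and bnd: "\<And>x. \<bar>F' x v\<bar> \<le> C * indicator (cball 0 r) x"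
    and F0: "\<And>x. \<bar>F x\<bar> \<le> C * indicator (cball 0 r) x"
    and C: "C \<ge> 0"
  shows "(LINT x|lborel. F' x v) = 0"
proof -
  have cont: "continuous_on UNIV F"
    using F' by (auto intro!: continuous_at_imp_continuous_on has_derivative_continuous)
  then have [measurable]: "F \<in> borel_measurable borel" by (rule borel_measurable_continuous_onI)
  define D where "D n x = real (Suc n) * (F (inverse (real (Suc n)) *\<^sub>R v + x) - F x)" for n x
  have [measurable]: "D n \<in> borel_measurable borel" for n
    unfolding D_def by measurable
  have intF: "integrable lborel F"
  proof (rule Bochner_Integration.integrable_bound)
    show "integrable lborel (\<lambda>x::'a. C * indicator (cball 0 r) x)"
      by (intro integrable_mult_right integrable_real_indicator emeasure_bounded_finite) auto
  qed (use F0 in \<open>auto simp: intro!: AE_I2 order_trans[OF F0]\<close>)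
  have D0: "(LINT x|lborel. D n x) = 0" for n
  proof -
    let ?c = "inverse (real (Suc n)) *\<^sub>R v"
    have shift: "integrable lborel (\<lambda>x. F (?c + x))" "(LINT x|lborel. F (?c + x)) = (LINT x|lborel. F x)"
    proof -
      have m: "(+) ?c \<in> lborel \<rightarrow>\<^sub>M borel" by measurable
      show "integrable lborel (\<lambda>x. F (?c + x))"
        using integrable_distr_eq[OF m, of F] intF by (simp only: lborel_distr_plus) simp
      show "(LINT x|lborel. F (?c + x)) = (LINT x|lborel. F x)"
        using integral_distr[OF m, of F] by (simp only: lborel_distr_plus) simp
    qed
    then show ?thesis using intF by (simp add: D_def)
  qed
  have lim: "(\<lambda>n. D n x) \<longlonglongrightarrow> F' x v" for x
  proof -
    have d: "((\<lambda>t. F (x + t *\<^sub>R v)) has_derivative (\<lambda>t. F' x (t *\<^sub>R v))) (at 0)"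
      by (rule has_derivative_compose[of "\<lambda>t. x + t *\<^sub>R v" "\<lambda>t. t *\<^sub>R v" 0 UNIV F "F' x", simplified])
        (auto intro!: derivative_eq_intros F')
    have "((\<lambda>t. F (x + t *\<^sub>R v)) has_real_derivative F' x v) (at 0)"
    proof -
      have "(\<lambda>t. F' x (t *\<^sub>R v)) = (*) (F' x v)"
        by (simp add: fun_eq_iff linear_cmul[OF has_derivative_linear[OF F']])
      with d show ?thesis by (simp add: has_field_derivative_def)
    qed
    then have "((\<lambda>t. (F (x + t *\<^sub>R v) - F x) / t) \<longlongrightarrow> F' x v) (at 0)"
      by (simp add: has_field_derivative_iff)
    moreover have "filterlim (\<lambda>n. inverse (real (Suc n))) (at 0) sequentially"
      using LIMSEQ_inverse_real_of_nat by (auto simp: filterlim_at)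
    ultimately have "(\<lambda>n. (F (x + inverse (real (Suc n)) *\<^sub>R v) - F x) / inverse (real (Suc n))) \<longlonglongrightarrow> F' x v"
      by (rule filterlim_compose)
    then show ?thesis by (simp add: D_def divide_inverse mult.commute add.commute)
  qed
  have bound: "\<bar>D n x\<bar> \<le> C * indicator (cball 0 (r + norm v)) x" for n x
  proof -
    let ?s = "inverse (real (Suc n))"
    have s: "0 < ?s" "?s \<le> 1" by (auto simp: inverse_eq_divide)
    have "\<exists>t\<in>{0<..<?s}. F (x + ?s *\<^sub>R v) - F (x + 0 *\<^sub>R v) = F' (x + t *\<^sub>R v) ((?s - 0) *\<^sub>R v)"
    proof (rule mvt_simple[of 0 ?s "\<lambda>t. F (x + t *\<^sub>R v)" "\<lambda>t h. F' (x + t *\<^sub>R v) (h *\<^sub>R v)"])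
      fix t
      show "((\<lambda>t. F (x + t *\<^sub>R v)) has_derivative (\<lambda>h. F' (x + t *\<^sub>R v) (h *\<^sub>R v))) (at t within {0..?s})"
        by (rule has_derivative_compose[of "\<lambda>t. x + t *\<^sub>R v" "\<lambda>t. t *\<^sub>R v" t "{0..?s}" F])
          (auto intro!: derivative_eq_intros F')
    qed (use s in auto)
    then obtain t where t: "0 < t" "t < ?s" "F (x + ?s *\<^sub>R v) - F x = F' (x + t *\<^sub>R v) (?s *\<^sub>R v)"
      by auto
    then have "D n x = F' (x + t *\<^sub>R v) v"
      by (simp add: D_def add.commute linear_cmul[OF has_derivative_linear[OF F']] del: of_nat_Suc)
    then have *: "\<bar>D n x\<bar> \<le> C * indicator (cball 0 r) (x + t *\<^sub>R v)"
      using bnd by simp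
    show ?thesis
    proof (cases "x + t *\<^sub>R v \<in> cball 0 r")
      case True
      \<comment> \<open>The intermediate point is at distance at most \<open>norm v\<close> from \<open>x\<close>; hence the larger ball.\<close>
    have "norm x \<le> norm (x + t *\<^sub>R v) + norm (t *\<^sub>R v)"
        using norm_triangle_ineq4[of "x + t *\<^sub>R v" "t *\<^sub>R v"] by simp
      also have "norm (t *\<^sub>R v) \<le> 1 * norm v"
        using t(1,2) s(2) unfolding norm_scaleR by (intro mult_right_mono) auto
      finally have "x \<in> cball 0 (r + norm v)" using True by simp
      then show ?thesis using * True by simp
    next
      case False
      then have "D n x = 0" using * by simp
      then show ?thesis using C by simp
    qed
  qed
  have "(\<lambda>n. LINT x|lborel. D n x) \<longlonglongrightarrow> (LINT x|lborel. F' x v)"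
  proof (rule integral_dominated_convergence)
    show "integrable lborel (\<lambda>x::'a. C * indicator (cball 0 (r + norm v)) x)"
      by (intro integrable_mult_right integrable_real_indicator emeasure_bounded_finite) auto
    show "(\<lambda>x. F' x v) \<in> borel_measurable lborel"
      by (rule borel_measurable_LIMSEQ_real[OF lim]) measurable
  qed (use lim bound in auto)
  then show ?thesis by (simp add: D0 LIMSEQ_const_iff)
qed


text \<open>
  The product rule reduces this to the vanishing of the integral of a derivative of \<open>\<phi> \<psi>\<close>.
\<close>

lemma test_fun_integration_by_parts:
  fixes \<phi> \<psi> :: "'a::euclidean_space \<Rightarrow> real"
  assumes \<phi>: "test_fun \<Omega> \<phi>" and \<psi>: "test_fun \<Omega>' \<psi>" and v: "v \<in> Basis"
  shows "abs_l2 \<phi> \<bullet> abs_l2 (\<lambda>x. frechet_derivative \<psi> (at x) v)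
    = - (abs_l2 (\<lambda>x. frechet_derivative \<phi> (at x) v) \<bullet> abs_l2 \<psi>)"
proof -
  let ?\<phi>' = "\<lambda>x. frechet_derivative \<phi> (at x) v" and ?\<psi>' = "\<lambda>x. frechet_derivative \<psi> (at x) v"
  note t = \<phi> \<psi> test_fun_deriv[OF \<phi> v] test_fun_deriv[OF \<psi> v]
  note si = t[THEN test_fun_square_integrable]
  obtain C0 r where C0: "C0 \<ge> 0" "\<And>x. \<bar>\<phi> x\<bar> \<le> C0 * indicator (cball 0 r) x"
    using test_fun_bounded[OF t(1)] by metis
  obtain C1 r1 where C1: "C1 \<ge> 0" "\<And>x. \<bar>\<psi> x\<bar> \<le> C1 * indicator (cball 0 r1) x"
    using test_fun_bounded[OF t(2)] by metis
  obtain C2 r2 where C2: "C2 \<ge> 0" "\<And>x. \<bar>?\<phi>' x\<bar> \<le> C2 * indicator (cball 0 r2) x"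
    using test_fun_bounded[OF t(3)] by metis
  obtain C3 r3 where C3: "C3 \<ge> 0" "\<And>x. \<bar>?\<psi>' x\<bar> \<le> C3 * indicator (cball 0 r3) x"
    using test_fun_bounded[OF t(4)] by metis
  define C where "C = max C0 (max C1 (max C2 C3))"
  define \<rho> where "\<rho> = max r r1"
  have b: "\<bar>\<phi> x\<bar> \<le> C" "\<bar>\<psi> x\<bar> \<le> C" "\<bar>?\<phi>' x\<bar> \<le> C" "\<bar>?\<psi>' x\<bar> \<le> C" for x
  proof -
    have drop: "\<bar>a\<bar> \<le> D" if "\<bar>a\<bar> \<le> D * indicator (cball 0 s) x" "D \<ge> 0" for a D :: real and s
      using that by (cases "x \<in> cball 0 s") auto
    show "\<bar>\<phi> x\<bar> \<le> C" "\<bar>\<psi> x\<bar> \<le> C" "\<bar>?\<phi>' x\<bar> \<le> C" "\<bar>?\<psi>' x\<bar> \<le> C"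
      using drop[OF C0(2)[of x] C0(1)] drop[OF C1(2)[of x] C1(1)]
        drop[OF C2(2)[of x] C2(1)] drop[OF C3(2)[of x] C3(1)]
      unfolding C_def by linarith+
  qed
  have C: "C \<ge> 0" using C0(1) by (simp add: C_def)
  have zero: "\<phi> x = 0 \<and> \<psi> x = 0" if "x \<notin> cball 0 \<rho>" for x
  proof -
    have "\<not> norm x \<le> r" "\<not> norm x \<le> r1" using that by (auto simp: \<rho>_def)
    then show ?thesis using C0(2)[of x] C1(2)[of x] by simp
  qed
  have prod: "\<bar>a * b\<bar> \<le> C * C" if "\<bar>a\<bar> \<le> C" "\<bar>b\<bar> \<le> C" for a b
    using that C by (simp add: abs_mult mult_mono)
  have "(LINT x|lborel. \<phi> x * ?\<psi>' x + ?\<phi>' x * \<psi> x) = 0"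
  proof (rule integral_directional_derivative_eq_0[where F = "\<lambda>x. \<phi> x * \<psi> x" and v = v
        and C = "C * C + C * C" and r = \<rho>])
    show "((\<lambda>x. \<phi> x * \<psi> x) has_derivative (\<lambda>v. \<phi> x * frechet_derivative \<psi> (at x) v +
        frechet_derivative \<phi> (at x) v * \<psi> x)) (at x)" for x
      using has_derivative_mult[OF test_fun_has_derivative[OF \<phi>] test_fun_has_derivative[OF \<psi>]] by simp
    show "\<bar>\<phi> x * ?\<psi>' x + ?\<phi>' x * \<psi> x\<bar> \<le> (C * C + C * C) * indicator (cball 0 \<rho>) x" for x
      using prod[of "\<phi> x" "?\<psi>' x"] prod[of "?\<phi>' x" "\<psi> x"] b[of x] zero[of x]
      by (cases "x \<in> cball 0 \<rho>") auto
    show "\<bar>\<phi> x * \<psi> x\<bar> \<le> (C * C + C * C) * indicator (cball 0 \<rho>) x" for x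
      using prod[of "\<phi> x" "\<psi> x"] b[of x] zero[of x] C
      by (cases "x \<in> cball 0 \<rho>") (auto intro: order_trans)
    show "C * C + C * C \<ge> 0" using C by simp
  qed
  also have "(LINT x|lborel. \<phi> x * ?\<psi>' x + ?\<phi>' x * \<psi> x)
      = (LINT x|lborel. \<phi> x * ?\<psi>' x) + (LINT x|lborel. ?\<phi>' x * \<psi> x)"
    by (intro Bochner_Integration.integral_add integrable_mult_square_integrable si)
  finally show ?thesis
    by (simp add: inner_abs_l2 si)
qed

section \<open>The fundamental lemma of the calculus of variations\<close>

lemma rep_diff_l2: "AE x in lborel. rep_l2 (f - g) x = rep_l2 f x - rep_l2 g x"
proof -
  have "f - g = abs_l2 (\<lambda>x. rep_l2 f x - rep_l2 g x)"
    using diff_abs_l2[OF square_integrable_rep_l2[of f] square_integrable_rep_l2[of g]] by simp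
  then show ?thesis
    using rep_abs_l2[OF square_integrable_diff[OF square_integrable_rep_l2[of f] square_integrable_rep_l2[of g]]]
    by simp
qed

lemma L2_diff:
  assumes "f \<in> L2 \<Omega>" "g \<in> L2 \<Omega>"
  shows "f - g \<in> L2 \<Omega>"
  using assms rep_diff_l2[of f g] unfolding L2_def mem_Collect_eq
  by eventually_elim simp

lemma square_integrable_indicator_box: "square_integrable (indicator (box a b))"
proof -
  have "(\<lambda>x. (indicator (box a b) x :: real)\<^sup>2) = indicator (box a b)"
    by (auto simp: indicator_def)
  then show ?thesis
    unfolding square_integrable_def
    by (auto intro!: integrable_real_indicator emeasure_bounded_finite bounded_box)
qed

text \<open>
  The indicator function of the box is the limit in \<open>L2\<close> of the test functions \<^const>\<open>box_bump\<close>.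
\<close>

lemma integral_box_eq_0:
  fixes h :: "'a::euclidean_space l2"
  assumes h: "\<And>\<phi>. test_fun \<Omega> \<phi> \<Longrightarrow> h \<bullet> abs_l2 \<phi> = 0" and box: "cbox a b \<subseteq> \<Omega>"
  shows "(LINT x|lborel. rep_l2 h x * indicator (box a b) x) = 0"
proof -
  note box_si = square_integrable_indicator_box[of a b]
  have bump: "test_fun \<Omega> (box_bump a b (real (Suc n)))" for n
    by (intro test_fun_box_bump box) simp
  have "(\<lambda>n. abs_l2 (box_bump a b (real (Suc n)))) \<longlonglongrightarrow> abs_l2 (indicator (box a b))"
  proof (rule l2_dominated_convergence[OF test_fun_square_integrable[OF bump] box_si box_si box_bump_tendsto])
    show "\<bar>box_bump a b (real (Suc n)) x\<bar> \<le> indicator (box a b) x" for n x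
      using box_bump_nonneg[of a b "real (Suc n)" x] box_bump_le_1[of a b "real (Suc n)" x]
        box_bump_outside[of "real (Suc n)" x a b]
      by (cases "x \<in> box a b") auto
  qed
  from tendsto_inner[OF tendsto_const[of h] this]
  have "h \<bullet> abs_l2 (indicator (box a b)) = 0"
    by (simp add: h bump LIMSEQ_const_iff del: of_nat_Suc)
  then show ?thesis
    using inner_abs_l2[OF square_integrable_rep_l2[of h] box_si] by simp
qed

text \<open>
  Boxes form an intersection-stable generator of the Borel sets, so Dynkin's theorem extends the vanishing
  of the integral from boxes contained in the given one to all of its Borel subsets, and the density is then
  zero. Passing to the closed box only adds a null set.
\<close>

lemma AE_eq_0_on_cbox:
  fixes h :: "'a::euclidean_space l2"
  assumes h: "\<And>\<phi>. test_fun \<Omega> \<phi> \<Longrightarrow> h \<bullet> abs_l2 \<phi> = 0" and box: "cbox a b \<subseteq> \<Omega>"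
  shows "AE x in lborel. x \<in> cbox a b \<longrightarrow> rep_l2 h x = 0"
proof -
  define F where "F x = rep_l2 h x * indicator (box a b) x" for x
  have F: "integrable lborel F"
    unfolding F_def
    by (intro integrable_mult_square_integrable square_integrable_rep_l2 square_integrable_indicator_box)
  have set_int: "set_integrable lborel A F" if "A \<in> sets borel" for A
    using F that unfolding set_integrable_def by (intro integrable_mult_indicator) auto
  have F0: "(LINT x|lborel. F x) = 0"
    unfolding F_def by (rule integral_box_eq_0[OF h box])
  have "(LINT x:A|lborel. F x) = 0" if "A \<in> sets borel" for A
  proof -
    have "Int_stable (range (\<lambda>(a, b). box a b :: 'a set))"
      by (auto simp: Int_stable_def box_Int_box)
    moreover have "range (\<lambda>(a, b). box a b :: 'a set) \<subseteq> Pow UNIV" by auto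
    moreover have "A \<in> sigma_sets UNIV (range (\<lambda>(a, b). box a b))"
      using that unfolding borel_eq_box by simp
    ultimately show ?thesis
    proof (induction rule: sigma_sets_induct_disjoint)
      case (basic A)
      then obtain c d where "A = box c d" by auto
      then obtain c' d' where A: "A \<inter> box a b = box c' d'" and "cbox c' d' \<subseteq> cbox a b"
      proof -
        assume A: "A = box c d"
        let ?c' = "\<Sum>i\<in>Basis. max (c \<bullet> i) (a \<bullet> i) *\<^sub>R i" and ?d' = "\<Sum>i\<in>Basis. min (d \<bullet> i) (b \<bullet> i) *\<^sub>R i"
        show thesis
        proof (rule that)
          show "A \<inter> box a b = box ?c' ?d'" unfolding A by (rule box_Int_box)
          show "cbox ?c' ?d' \<subseteq> cbox a b" by (auto simp: mem_box)
        qed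
      qed
      then have "(LINT x|lborel. rep_l2 h x * indicator (A \<inter> box a b) x) = 0"
        using box unfolding A by (intro integral_box_eq_0[where \<Omega> = \<Omega>] h) auto
      then show ?case
        by (simp add: set_lebesgue_integral_def F_def indicator_inter_arith mult_ac)
    next
      case empty
      then show ?case by (simp add: set_lebesgue_integral_def)
    next
      case (compl A)
      then have A: "A \<in> sets borel" by (simp add: borel_eq_box)
      have "(LINT x:(UNIV - A)|lborel. F x) = (LINT x|lborel. F x - indicator A x *\<^sub>R F x)"
        unfolding set_lebesgue_integral_def
        by (intro Bochner_Integration.integral_cong) (auto simp: indicator_def)
      also have "\<dots> = (LINT x|lborel. F x) - (LINT x:A|lborel. F x)"
        unfolding set_lebesgue_integral_def using F set_int[OF A] unfolding set_integrable_def
        by (intro Bochner_Integration.integral_diff)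
      finally show ?case using compl F0 by simp
    next
      case (union A)
      then have A: "A i \<in> sets borel" for i by (auto simp: borel_eq_box)
      have "(LINT x:(\<Union>i. A i)|lborel. F x) = (\<Sum>i. LINT x:A i|lborel. F x)"
        using A union(1) by (intro lebesgue_integral_countable_add set_int)
          (auto simp: disjoint_family_on_def)
      then show ?case using union by simp
    qed
  qed
  then have "AE x in lborel. F x = 0"
    using F by (intro density_unique_real) (auto simp: set_lebesgue_integral_def)
  moreover have "AE x in lborel. x \<notin> cbox a b - box a b"
  proof (rule AE_not_in)
    have "emeasure lborel (cbox a b - box a b) = emeasure lborel (cbox a b) - emeasure lborel (box a b)"
      by (intro emeasure_Diff) (auto simp: emeasure_lborel_box_eq box_subset_cbox)
    also have "\<dots> = 0"
      by (auto simp: emeasure_lborel_box_eq emeasure_lborel_cbox_eq)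
    finally show "cbox a b - box a b \<in> null_sets lborel" by auto
  qed
  ultimately show ?thesis
    by eventually_elim (auto simp: F_def)
qed

text \<open>
  An open set is a countable union of closed boxes, and \<open>h\<close> vanishes almost everywhere on each of them.
\<close>

lemma L2_eq_0_if_orthogonal_to_test_funs:
  fixes h :: "'a::euclidean_space l2"
  assumes \<Omega>: "open \<Omega>" and hL: "h \<in> L2 \<Omega>"
    and h: "\<And>\<phi>. test_fun \<Omega> \<phi> \<Longrightarrow> h \<bullet> abs_l2 \<phi> = 0"
  shows "h = 0"
proof -
  obtain \<D> where \<D>: "countable \<D>" "\<And>X. X \<in> \<D> \<Longrightarrow> X \<subseteq> \<Omega>" "\<And>X. X \<in> \<D> \<Longrightarrow> \<exists>a b. X = cbox a b" "\<Union>\<D> = \<Omega>"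
    using open_countable_Union_open_cbox[OF \<Omega>] by (metis Pow_iff subsetD)
  have "AE x in lborel. \<forall>X\<in>\<D>. x \<in> X \<longrightarrow> rep_l2 h x = 0"
    unfolding AE_ball_countable[OF \<D>(1)]
    using \<D>(2,3) AE_eq_0_on_cbox[OF h] by blast
  moreover have "AE x in lborel. x \<notin> \<Omega> \<longrightarrow> rep_l2 h x = 0"
    using hL by (simp add: L2_def)
  ultimately have "AE x in lborel. rep_l2 h x = 0"
    by eventually_elim (use \<D>(4) in blast)
  then have "abs_l2 (rep_l2 h) = abs_l2 (\<lambda>x. 0)"
    by (subst abs_l2_eq_iff) (auto simp: square_integrable_rep_l2)
  then show ?thesis by (simp add: zero_l2_def)
qed

section \<open>Weak derivatives and the space of functions vanishing on the boundary\<close>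

lemma has_weak_deriv_iff_inner:
  "has_weak_deriv \<Omega> i f g \<longleftrightarrow> g \<in> L2 \<Omega> \<and> (\<forall>\<phi>. test_fun \<Omega> \<phi> \<longrightarrow>
     f \<bullet> abs_l2 (\<lambda>x. frechet_derivative \<phi> (at x) (axis i 1)) = - (g \<bullet> abs_l2 \<phi>))"
  unfolding has_weak_deriv_def
  by (intro conj_cong refl all_cong)
    (simp add: integral_test_fun_eq_inner test_fun_deriv)

lemma has_weak_deriv_diff:
  "has_weak_deriv \<Omega> i f g \<Longrightarrow> has_weak_deriv \<Omega> i f' g' \<Longrightarrow> has_weak_deriv \<Omega> i (f - f') (g - g')"
  by (simp add: has_weak_deriv_iff_inner L2_diff inner_diff_left)

text \<open>
  The difference of two weak derivatives is orthogonal to all test functions.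
\<close>

lemma weak_deriv_eqI:
  assumes \<Omega>: "open \<Omega>" and g: "has_weak_deriv \<Omega> i f g"
  shows "weak_deriv \<Omega> i f = g"
  unfolding weak_deriv_def
proof (rule the_equality)
  fix h assume "has_weak_deriv \<Omega> i f h"
  from has_weak_deriv_diff[OF this g] have "has_weak_deriv \<Omega> i 0 (h - g)" by simp
  then have "h - g = 0"
    by (intro L2_eq_0_if_orthogonal_to_test_funs[OF \<Omega>]) (simp_all add: has_weak_deriv_iff_inner)
  then show "h = g" by simp
qed (rule g)

lemma has_weak_deriv_weak_deriv:
  assumes "open \<Omega>" "f \<in> H1 \<Omega>"
  shows "has_weak_deriv \<Omega> i f (weak_deriv \<Omega> i f)"
proof -
  obtain g where g: "has_weak_deriv \<Omega> i f g" using assms(2) by (auto simp: H1_def)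
  with weak_deriv_eqI[OF assms(1) g] show ?thesis by simp
qed

lemma H1_diff:
  assumes "open \<Omega>" "f \<in> H1 \<Omega>" "g \<in> H1 \<Omega>"
  shows "f - g \<in> H1 \<Omega>" "weak_deriv \<Omega> i (f - g) = weak_deriv \<Omega> i f - weak_deriv \<Omega> i g"
proof -
  have *: "has_weak_deriv \<Omega> i (f - g) (weak_deriv \<Omega> i f - weak_deriv \<Omega> i g)" for i
    by (intro has_weak_deriv_diff has_weak_deriv_weak_deriv assms)
  then show "f - g \<in> H1 \<Omega>"
    using assms L2_diff by (auto simp: H1_def)
  show "weak_deriv \<Omega> i (f - g) = weak_deriv \<Omega> i f - weak_deriv \<Omega> i g"
    by (rule weak_deriv_eqI[OF assms(1) *])
qed

lemma test_fun_L2: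
  assumes "test_fun \<Omega> \<phi>"
  shows "abs_l2 \<phi> \<in> L2 \<Omega>"
  using rep_abs_l2[OF test_fun_square_integrable[OF assms]] unfolding L2_def mem_Collect_eq
  by eventually_elim (simp add: test_fun_outside[OF assms])

lemma test_fun_H1:
  assumes "test_fun \<Omega> \<phi>"
  shows "abs_l2 \<phi> \<in> H1 \<Omega>"
proof -
  have "has_weak_deriv \<Omega> i (abs_l2 \<phi>) (abs_l2 (\<lambda>x. frechet_derivative \<phi> (at x) (axis i 1)))" for i
    unfolding has_weak_deriv_iff_inner
    by (auto intro!: test_fun_L2 test_fun_deriv test_fun_integration_by_parts assms)
  then show ?thesis using test_fun_L2[OF assms] by (auto simp: H1_def)
qed

lemma H1_norm_tendsto_0_iff:
  fixes X :: "nat \<Rightarrow> (real^'n) l2"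
  shows "(\<lambda>k. H1_norm \<Omega> (X k)) \<longlonglongrightarrow> 0 \<longleftrightarrow> X \<longlonglongrightarrow> 0 \<and> (\<forall>i. (\<lambda>k. weak_deriv \<Omega> i (X k)) \<longlonglongrightarrow> 0)"
proof (intro iffI conjI allI)
  assume lim: "(\<lambda>k. H1_norm \<Omega> (X k)) \<longlonglongrightarrow> 0"
  have "norm (X k) \<le> H1_norm \<Omega> (X k)" for k
    unfolding H1_norm_def by (intro real_le_rsqrt) (simp add: sum_nonneg)
  then show "X \<longlonglongrightarrow> 0"
    by (intro Lim_null_comparison[OF _ lim] always_eventually) simp
  fix i
  have "(norm (weak_deriv \<Omega> i (X k)))\<^sup>2 \<le> (\<Sum>i\<in>UNIV. (norm (weak_deriv \<Omega> i (X k)))\<^sup>2)" for k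
    by (rule member_le_sum) auto
  then have "norm (weak_deriv \<Omega> i (X k)) \<le> H1_norm \<Omega> (X k)" for k
    unfolding H1_norm_def by (intro real_le_rsqrt) (simp add: add_increasing)
  then show "(\<lambda>k. weak_deriv \<Omega> i (X k)) \<longlonglongrightarrow> 0"
    by (intro Lim_null_comparison[OF _ lim] always_eventually) simp
next
  assume "X \<longlonglongrightarrow> 0 \<and> (\<forall>i. (\<lambda>k. weak_deriv \<Omega> i (X k)) \<longlonglongrightarrow> 0)"
  then have "(\<lambda>k. H1_norm \<Omega> (X k)) \<longlonglongrightarrow>
      sqrt ((norm (0::(real^'n) l2))\<^sup>2 + (\<Sum>i\<in>(UNIV::'n set). (norm (0::(real^'n) l2))\<^sup>2))"
    unfolding H1_norm_def by (intro tendsto_intros) auto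
  then show "(\<lambda>k. H1_norm \<Omega> (X k)) \<longlonglongrightarrow> 0" by simp
qed

text \<open>
  Splitting the norm into convergence of the functions and of their weak derivatives makes both closure under
  differences and the passage to the limit in the bilinear form immediate. The splitting uses that \<^const>\<open>weak_deriv\<close>
  is additive on \<open>f - abs_l2 (\<phi> k)\<close>, hence that test functions are in \<^const>\<open>H1\<close>.
\<close>

lemma H1_0_iff:
  assumes "open \<Omega>"
  shows "f \<in> H1_0 \<Omega> \<longleftrightarrow> f \<in> H1 \<Omega> \<and> (\<exists>\<phi>. (\<forall>k. test_fun \<Omega> (\<phi> k)) \<and> (\<lambda>k. abs_l2 (\<phi> k)) \<longlonglongrightarrow> f \<and>
    (\<forall>i. (\<lambda>k. weak_deriv \<Omega> i (abs_l2 (\<phi> k))) \<longlonglongrightarrow> weak_deriv \<Omega> i f))"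
proof -
  have flip: "(\<lambda>k. g - Y k) \<longlonglongrightarrow> 0 \<longleftrightarrow> Y \<longlonglongrightarrow> g" for g and Y :: "nat \<Rightarrow> (real^'a) l2"
    using Lim_null[of Y g sequentially] tendsto_minus_cancel_left[of "\<lambda>k. g - Y k" 0 sequentially] by simp
  have "(\<lambda>k. H1_norm \<Omega> (f - abs_l2 (\<phi> k))) \<longlonglongrightarrow> 0 \<longleftrightarrow> (\<lambda>k. abs_l2 (\<phi> k)) \<longlonglongrightarrow> f \<and>
      (\<forall>i. (\<lambda>k. weak_deriv \<Omega> i (abs_l2 (\<phi> k))) \<longlonglongrightarrow> weak_deriv \<Omega> i f)"
    if "f \<in> H1 \<Omega>" "\<forall>k. test_fun \<Omega> (\<phi> k)" for \<phi>
    using that by (simp add: H1_norm_tendsto_0_iff H1_diff[OF assms] test_fun_H1 flip)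
  then show ?thesis unfolding H1_0_def by blast
qed

lemma H1_0_diff:
  assumes \<Omega>: "open \<Omega>" and f: "f \<in> H1_0 \<Omega>" and g: "g \<in> H1_0 \<Omega>"
  shows "f - g \<in> H1_0 \<Omega>"
proof -
  obtain \<phi> \<psi> where \<phi>: "\<forall>k. test_fun \<Omega> (\<phi> k)" "(\<lambda>k. abs_l2 (\<phi> k)) \<longlonglongrightarrow> f"
      "\<forall>i. (\<lambda>k. weak_deriv \<Omega> i (abs_l2 (\<phi> k))) \<longlonglongrightarrow> weak_deriv \<Omega> i f"
    and \<psi>: "\<forall>k. test_fun \<Omega> (\<psi> k)" "(\<lambda>k. abs_l2 (\<psi> k)) \<longlonglongrightarrow> g"
      "\<forall>i. (\<lambda>k. weak_deriv \<Omega> i (abs_l2 (\<psi> k))) \<longlonglongrightarrow> weak_deriv \<Omega> i g"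
    and fg: "f \<in> H1 \<Omega>" "g \<in> H1 \<Omega>"
    using f g unfolding H1_0_iff[OF \<Omega>] by blast
  have eq: "abs_l2 (\<lambda>x. \<phi> k x - \<psi> k x) = abs_l2 (\<phi> k) - abs_l2 (\<psi> k)" for k
    using \<phi>(1) \<psi>(1) by (intro diff_abs_l2[symmetric]) (blast intro: test_fun_square_integrable)+
  show ?thesis
    unfolding H1_0_iff[OF \<Omega>]
    using \<phi> \<psi> fg
    by (intro conjI exI[of _ "\<lambda>k x. \<phi> k x - \<psi> k x"])
      (auto simp: eq H1_diff[OF \<Omega>] test_fun_H1 intro: test_fun_diff tendsto_diff)
qed

section \<open>The bilinear form of the elliptic operator\<close>

text \<open>
  Multiplication by a bounded coefficient, as an operator on \<open>L2\<close>. It turns every term of \<^const>\<open>L_pairing\<close>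
  into an inner product.
\<close>

definition L2_multiply ::
  "'a::euclidean_space set \<Rightarrow> ('a \<Rightarrow> real) \<Rightarrow> 'a l2 \<Rightarrow> 'a l2" where
  "L2_multiply \<Omega> a f = abs_l2 (\<lambda>x. indicator \<Omega> x * a x * rep_l2 f x)"

lemma square_integrable_Linf_mult:
  fixes a :: "'a::euclidean_space \<Rightarrow> real"
  assumes "Linf \<Omega> a"
  shows "square_integrable (\<lambda>x. indicator \<Omega> x * a x * rep_l2 f x)"
proof -
  have si: "square_integrable (rep_l2 f)" by (rule square_integrable_rep_l2)
  then have [measurable]: "rep_l2 f \<in> borel_measurable lborel" by (simp add: square_integrable_def)
  have "(\<lambda>x. indicator \<Omega> x *\<^sub>R a x) \<in> borel_measurable lborel"
    using assms by (simp add: Linf_def set_borel_measurable_def)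
  then have [measurable]: "(\<lambda>x. indicator \<Omega> x * a x) \<in> borel_measurable lborel" by simp
  obtain C where C: "AE x in lborel. x \<in> \<Omega> \<longrightarrow> norm (a x) \<le> C"
    using assms by (auto simp: Linf_def)
  have "integrable lborel (\<lambda>x. (indicator \<Omega> x * a x * rep_l2 f x)\<^sup>2)"
  proof (rule Bochner_Integration.integrable_bound)
    show "integrable lborel (\<lambda>x. C\<^sup>2 * (rep_l2 f x)\<^sup>2)"
      using si by (simp add: square_integrable_def)
    show "AE x in lborel. norm ((indicator \<Omega> x * a x * rep_l2 f x)\<^sup>2) \<le> norm (C\<^sup>2 * (rep_l2 f x)\<^sup>2)"
      using C
    proof eventually_elim
      case (elim x)
      show ?case
      proof (cases "x \<in> \<Omega>")
        case True
        then have "\<bar>a x\<bar>\<^sup>2 \<le> C\<^sup>2" using elim by (intro power_mono) auto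
        then show ?thesis using True by (simp add: power_mult_distrib mult_right_mono)
      qed simp
    qed
  qed measurable
  then show ?thesis by (simp add: square_integrable_def)
qed

lemma L2_multiply_inner:
  fixes a :: "'a::euclidean_space \<Rightarrow> real"
  assumes "Linf \<Omega> a"
  shows "set_integrable lborel \<Omega> (\<lambda>x. a x * rep_l2 f x * rep_l2 g x)"
    and "(LINT x:\<Omega>|lborel. a x * rep_l2 f x * rep_l2 g x) = L2_multiply \<Omega> a f \<bullet> g"
proof -
  note si = square_integrable_Linf_mult[OF assms, of f] square_integrable_rep_l2[of g]
  show "set_integrable lborel \<Omega> (\<lambda>x. a x * rep_l2 f x * rep_l2 g x)"
    using integrable_mult_square_integrable[OF si] by (simp add: set_integrable_def mult.assoc)
  show "(LINT x:\<Omega>|lborel. a x * rep_l2 f x * rep_l2 g x) = L2_multiply \<Omega> a f \<bullet> g"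
    using inner_abs_l2[OF si] by (simp add: L2_multiply_def set_lebesgue_integral_def mult.assoc)
qed

lemma L2_multiply_diff:
  fixes a :: "'a::euclidean_space \<Rightarrow> real"
  assumes "Linf \<Omega> a"
  shows "L2_multiply \<Omega> a (f - g) = L2_multiply \<Omega> a f - L2_multiply \<Omega> a g"
proof -
  note si = square_integrable_Linf_mult[OF assms]
  have "AE x in lborel. indicator \<Omega> x * a x * rep_l2 (f - g) x
      = indicator \<Omega> x * a x * rep_l2 f x - indicator \<Omega> x * a x * rep_l2 g x"
    using rep_diff_l2[of f g] by eventually_elim (simp add: right_diff_distrib)
  then show ?thesis
    unfolding L2_multiply_def diff_abs_l2[OF si si]
    by (subst abs_l2_eq_iff) (auto intro: si square_integrable_diff)
qed

lemma Linf_vec_nth: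
  fixes b :: "'a::euclidean_space \<Rightarrow> 'b::euclidean_space^'n"
  assumes "Linf \<Omega> b"
  shows "Linf \<Omega> (\<lambda>x. b x $ i)"
  unfolding Linf_def
proof
  have "(\<lambda>x. (indicator \<Omega> x *\<^sub>R b x) $ i) \<in> borel_measurable lborel"
    using assms unfolding Linf_def set_borel_measurable_def
    by (intro borel_measurable_continuous_on[where f = "\<lambda>v. v $ i"])
      (auto intro: linear_continuous_on bounded_linear_vec_nth)
  then show "set_borel_measurable lborel \<Omega> (\<lambda>x. b x $ i)"
    by (simp add: set_borel_measurable_def)
  obtain C where "AE x in lborel. x \<in> \<Omega> \<longrightarrow> norm (b x) \<le> C"
    using assms by (auto simp: Linf_def)
  then have "AE x in lborel. x \<in> \<Omega> \<longrightarrow> norm (b x $ i) \<le> C"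
    by eventually_elim (auto intro: order_trans[OF Finite_Cartesian_Product.norm_nth_le])
  then show "\<exists>C. AE x in lborel. x \<in> \<Omega> \<longrightarrow> norm (b x $ i) \<le> C" by blast
qed

text \<open>
  In this form the pairing is visibly additive in \<open>r\<close> on \<^const>\<open>H1\<close> and, for fixed \<open>r\<close>, continuous in \<open>s\<close> under
  convergence of \<open>s\<close> and its weak derivatives in \<open>L2\<close>.
\<close>

lemma L_pairing_eq_inner:
  fixes \<Omega> :: "(real^'n) set"
  assumes ell: "elliptic \<Omega> A b c"
  shows "L_pairing \<Omega> A b c r s =
    (\<Sum>i\<in>UNIV. \<Sum>j\<in>UNIV. L2_multiply \<Omega> (\<lambda>x. A x $ i $ j) (weak_deriv \<Omega> j r) \<bullet> weak_deriv \<Omega> i s)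
    + (\<Sum>i\<in>UNIV. L2_multiply \<Omega> (\<lambda>x. b x $ i) (weak_deriv \<Omega> i r) \<bullet> s)
    + L2_multiply \<Omega> c r \<bullet> s"
proof -
  have coeff: "Linf \<Omega> (\<lambda>x. A x $ i $ j)" "Linf \<Omega> (\<lambda>x. b x $ i)" "Linf \<Omega> c" for i j
    using ell by (auto simp: elliptic_def intro!: Linf_vec_nth)
  let ?A = "\<lambda>i j x. indicator \<Omega> x *\<^sub>R (A x $ i $ j * rep_l2 (weak_deriv \<Omega> j r) x * rep_l2 (weak_deriv \<Omega> i s) x)"
  let ?b = "\<lambda>i x. indicator \<Omega> x *\<^sub>R (b x $ i * rep_l2 (weak_deriv \<Omega> i r) x * rep_l2 s x)"
  let ?c = "\<lambda>x. indicator \<Omega> x *\<^sub>R (c x * rep_l2 r x * rep_l2 s x)"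
  note int = L2_multiply_inner(1)[OF coeff(1), unfolded set_integrable_def]
    L2_multiply_inner(1)[OF coeff(2), unfolded set_integrable_def]
    L2_multiply_inner(1)[OF coeff(3), unfolded set_integrable_def]
  note eq = coeff[THEN L2_multiply_inner(2), unfolded set_lebesgue_integral_def, symmetric]
  have "L_pairing \<Omega> A b c r s
      = (LINT x|lborel. (\<Sum>i\<in>UNIV. \<Sum>j\<in>UNIV. ?A i j x) + (\<Sum>i\<in>UNIV. ?b i x) + ?c x)"
    unfolding L_pairing_def set_lebesgue_integral_def
    by (intro Bochner_Integration.integral_cong)
      (simp_all add: weak_grad_def inner_vec_def matrix_vector_mult_def sum_distrib_left
        sum_distrib_right distrib_left mult.assoc)
  also have "\<dots> = (\<Sum>i\<in>UNIV. \<Sum>j\<in>UNIV. LINT x|lborel. ?A i j x) + (\<Sum>i\<in>UNIV. LINT x|lborel. ?b i x)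
      + (LINT x|lborel. ?c x)"
    using int by (simp only: Bochner_Integration.integral_add Bochner_Integration.integral_sum
        Bochner_Integration.integrable_add Bochner_Integration.integrable_sum)
  finally show ?thesis by (simp only: eq)
qed

lemma L_pairing_diff_left:
  fixes \<Omega> :: "(real^'n) set"
  assumes "open \<Omega>" "elliptic \<Omega> A b c" "r \<in> H1 \<Omega>" "r' \<in> H1 \<Omega>"
  shows "L_pairing \<Omega> A b c (r - r') s = L_pairing \<Omega> A b c r s - L_pairing \<Omega> A b c r' s"
proof -
  have coeff: "Linf \<Omega> (\<lambda>x. A x $ i $ j)" "Linf \<Omega> (\<lambda>x. b x $ i)" "Linf \<Omega> c" for i j
    using assms(2) by (auto simp: elliptic_def intro!: Linf_vec_nth)
  show ?thesis
    using assms by (simp add: L_pairing_eq_inner H1_diff L2_multiply_diff coeff inner_diff_left sum_subtractf)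
qed

text \<open>
  Both sides are continuous along a sequence of test functions that converges to \<open>s\<close> in \<^const>\<open>H1\<close>.
\<close>

lemma weak_formulation_extends_to_H1_0:
  fixes \<Omega> :: "(real^'n) set"
  assumes \<Omega>: "open \<Omega>" and ell: "elliptic \<Omega> A b c" and s: "s \<in> H1_0 \<Omega>"
    and weak: "\<And>\<phi>. test_fun \<Omega> \<phi> \<Longrightarrow> d \<bullet> abs_l2 \<phi> + L_pairing \<Omega> A b c r (abs_l2 \<phi>) = R \<bullet> abs_l2 \<phi>"
  shows "d \<bullet> s + L_pairing \<Omega> A b c r s = R \<bullet> s"
proof -
  obtain \<phi> where \<phi>: "\<And>k. test_fun \<Omega> (\<phi> k)" "(\<lambda>k. abs_l2 (\<phi> k)) \<longlonglongrightarrow> s"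
      "\<And>i. (\<lambda>k. weak_deriv \<Omega> i (abs_l2 (\<phi> k))) \<longlonglongrightarrow> weak_deriv \<Omega> i s"
    using s unfolding H1_0_iff[OF \<Omega>] by blast
  have "(\<lambda>k. d \<bullet> abs_l2 (\<phi> k) + L_pairing \<Omega> A b c r (abs_l2 (\<phi> k))) \<longlonglongrightarrow> d \<bullet> s + L_pairing \<Omega> A b c r s"
    unfolding L_pairing_eq_inner[OF ell] by (intro tendsto_intros \<phi>)
  moreover have "(\<lambda>k. R \<bullet> abs_l2 (\<phi> k)) \<longlonglongrightarrow> R \<bullet> s"
    by (intro tendsto_intros \<phi>)
  ultimately show ?thesis
    using LIMSEQ_unique by (simp add: weak \<phi>(1))
qed

section \<open>The error bound\<close>

theorem corollary3p5:
  fixes \<Omega> :: "(real^'n) set" and T :: real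
    and A :: "real^'n \<Rightarrow> real^'n^'n" and b :: "real^'n \<Rightarrow> real^'n" and c :: "real^'n \<Rightarrow> real"
    and l :: nat and \<alpha> :: "nat \<Rightarrow> real" and q :: "nat \<Rightarrow> real \<Rightarrow> real" and lam :: real
    and f :: "real^'n \<Rightarrow> real \<Rightarrow> real" and u0 :: "(real^'n) l2"
    and u uh R :: "real \<Rightarrow> (real^'n) l2" and w :: "real \<Rightarrow> real"
  assumes "CARD('n) \<in> {1, 2, 3}"
    and "bounded_lipschitz_domain \<Omega>"
    and "T > 0"
    and "elliptic \<Omega> A b c"
    and "l \<ge> 1"
    and "\<forall>i\<in>{1..l}. 0 < \<alpha> i \<and> \<alpha> i \<le> 1"
    and "\<forall>i\<in>{1..l}. \<forall>j\<in>{1..l}. i < j \<longrightarrow> \<alpha> j < \<alpha> i"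
    and "\<forall>i\<in>{1..l}. continuous_on {0..T} (q i)"
    and "\<forall>i\<in>{1..l}. \<forall>t\<in>{0..T}. q i t \<ge> 0"
    and "\<forall>t\<in>{0..T}. (\<Sum>i=1..l. q i t) > 0"
    and "lam \<ge> 0"
    and "\<forall>r\<in>H1_0 \<Omega>. L_pairing \<Omega> A b c r r \<ge> lam * (norm r)\<^sup>2"
    and "\<forall>t\<in>{0<..T}. loc_integrable \<Omega> (\<lambda>x. f x t)"
    and "is_solution l q \<alpha> \<Omega> A b c f T u0 u"
    and "\<forall>v. is_solution l q \<alpha> \<Omega> A b c f T u0 v \<longrightarrow> (\<forall>t\<in>{0..T}. v t = u t)"
    and "admissible \<Omega> T uh"
    and "uh 0 = u 0"
    and "\<forall>t\<in>{0<..T}. is_residual l q \<alpha> \<Omega> A b c f uh t (R t)"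
    and "multiterm_inverse l q \<alpha> lam T (\<lambda>t. norm (R t)) w"
  shows "\<forall>t\<in>{0<..T}. norm (uh t - u t) \<le> w t"
proof -
  note ell = assms(4) and \<alpha> = assms(6) and q = assms(9,10) and lam = assms(11) and coercive = assms(12)
  have \<Omega>: "open \<Omega>" using assms(2) by (simp add: bounded_lipschitz_domain_def)
  have u: "continuous_on {0..T} u" "\<And>t. t \<in> {0<..T} \<Longrightarrow> u t \<in> H1_0 \<Omega>"
      "\<And>t. t \<in> {0<..T} \<Longrightarrow> is_residual l q \<alpha> \<Omega> A b c f u t 0"
    using assms(14) by (auto simp: is_solution_def admissible_def)
  have uh: "continuous_on {0..T} uh" "\<And>t. t \<in> {0<..T} \<Longrightarrow> uh t \<in> H1_0 \<Omega>"
    using assms(16) by (auto simp: admissible_def)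
  have w: "continuous_on {0..T} w" "w 0 = 0"
      "\<And>t. t \<in> {0<..T} \<Longrightarrow> \<exists>d. has_multiterm_deriv l q \<alpha> w t d \<and> d + lam * w t = norm (R t)"
    using assms(19) by (auto simp: multiterm_inverse_def)
  define e where "e t = uh t - u t" for t

  \<comment> \<open>Testing the difference of the two equations with \<open>e t\<close> and dividing by its norm.\<close>
  have energy: "\<exists>D. has_multiterm_deriv l q \<alpha> (\<lambda>t. norm (e t)) t D \<and> D + lam * norm (e t) \<le> norm (R t)"
    if t: "t \<in> {0<..T}" and nz: "e t \<noteq> 0" for t
  proof -
    have H1_0: "e t \<in> H1_0 \<Omega>" unfolding e_def by (intro H1_0_diff \<Omega> u uh t)
    have H1: "u t \<in> H1 \<Omega>" "uh t \<in> H1 \<Omega>" using u(2)[OF t] uh(2)[OF t] by (auto simp: H1_0_def)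
    obtain d1 where d1: "has_multiterm_deriv l q \<alpha> u t d1"
        "\<And>\<phi>. test_fun \<Omega> \<phi> \<Longrightarrow> d1 \<bullet> abs_l2 \<phi> + L_pairing \<Omega> A b c (u t) (abs_l2 \<phi>)
           - (LINT x:\<Omega>|lborel. f x t * \<phi> x) = 0 \<bullet> abs_l2 \<phi>"
      using u(3)[OF t] unfolding is_residual_def by blast
    obtain d2 where d2: "has_multiterm_deriv l q \<alpha> uh t d2"
        "\<And>\<phi>. test_fun \<Omega> \<phi> \<Longrightarrow> d2 \<bullet> abs_l2 \<phi> + L_pairing \<Omega> A b c (uh t) (abs_l2 \<phi>)
           - (LINT x:\<Omega>|lborel. f x t * \<phi> x) = R t \<bullet> abs_l2 \<phi>"
      using assms(18) t unfolding is_residual_def by blast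
    have weak: "(d2 - d1) \<bullet> abs_l2 \<phi> + L_pairing \<Omega> A b c (e t) (abs_l2 \<phi>) = R t \<bullet> abs_l2 \<phi>"
      if "test_fun \<Omega> \<phi>" for \<phi>
      using d1(2)[OF that] d2(2)[OF that]
      by (simp add: e_def L_pairing_diff_left[OF \<Omega> ell H1(2,1)] inner_diff_left)
    have "(d2 - d1) \<bullet> e t + L_pairing \<Omega> A b c (e t) (e t) = R t \<bullet> e t"
      by (rule weak_formulation_extends_to_H1_0[OF \<Omega> ell H1_0 weak])
    moreover have "L_pairing \<Omega> A b c (e t) (e t) \<ge> lam * (norm (e t))\<^sup>2"
      using coercive H1_0 by blast
    moreover have "R t \<bullet> e t \<le> norm (R t) * norm (e t)" by (rule norm_cauchy_schwarz)
    moreover have deriv: "has_multiterm_deriv l q \<alpha> e t (d2 - d1)"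
      unfolding e_def by (rule has_multiterm_deriv_diff[OF d2(1) d1(1)])
    obtain D where D: "has_multiterm_deriv l q \<alpha> (\<lambda>t. norm (e t)) t D"
        "D * norm (e t) \<le> (d2 - d1) \<bullet> e t"
    proof -
      have "\<forall>i\<in>{1..l}. q i t \<ge> 0" using q(1) t by simp
      from has_multiterm_deriv_norm[of l q \<alpha> e t, OF deriv \<alpha> this nz] that show thesis by blast
    qed
    ultimately have "(D + lam * norm (e t)) * norm (e t) \<le> norm (R t) * norm (e t)"
      by (simp add: distrib_right power2_eq_square mult.assoc)
    then have "D + lam * norm (e t) \<le> norm (R t)" using nz by simp
    with D(1) show ?thesis by blast
  qed

  \<comment> \<open>The right-hand side \<open>norm (R t)\<close> is nonnegative, so \<open>- w\<close> is a subsolution.\<close>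
  have w_nonneg: "0 \<le> w t" if t: "t \<in> {0..T}" for t
  proof -
    have "0 - w t \<le> 0"
    proof (rule multiterm_comparison[OF \<alpha> q lam _ _ _ t])
      fix s assume "s \<in> {0<..T}"
      then obtain d where d: "has_multiterm_deriv l q \<alpha> w s d" "d + lam * w s = norm (R s)"
        using w(3) by blast
      have "has_multiterm_deriv l q \<alpha> (\<lambda>t. 0 - w t) s (0 - d)"
        by (rule has_multiterm_deriv_diff[OF has_multiterm_deriv_0 d(1)])
      moreover have "(0 - d) + lam * (0 - w s) = - norm (R s)"
        using d(2) by (simp add: algebra_simps)
      then have "(0 - d) + lam * (0 - w s) \<le> 0" by simp
      ultimately show "\<exists>d. has_multiterm_deriv l q \<alpha> (\<lambda>t. 0 - w t) s d \<and> d + lam * (0 - w s) \<le> 0"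
        by blast
    qed (auto intro!: continuous_intros simp: w)
    then show ?thesis by simp
  qed

  have "norm (e t) - w t \<le> 0" if t: "t \<in> {0..T}" for t
  proof (rule multiterm_comparison[OF \<alpha> q lam _ _ _ t])
    show "continuous_on {0..T} (\<lambda>t. norm (e t) - w t)"
      unfolding e_def by (intro continuous_intros u uh w)
    show "norm (e 0) - w 0 \<le> 0" by (simp add: e_def assms(17) w)
    fix s assume s: "s \<in> {0<..T}" and pos: "norm (e s) - w s > 0"
    have "w s \<ge> 0" using s by (intro w_nonneg) auto
    \<comment> \<open>Nonnegativity of \<open>w\<close> keeps away from the zeros of \<open>e\<close>, where its norm may fail to be differentiable.\<close>
    with pos have "e s \<noteq> 0" by auto
    from energy[OF s this] obtain D where D: "has_multiterm_deriv l q \<alpha> (\<lambda>t. norm (e t)) s D"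
        "D + lam * norm (e s) \<le> norm (R s)" by blast
    obtain d where d: "has_multiterm_deriv l q \<alpha> w s d" "d + lam * w s = norm (R s)"
      using w(3)[OF s] by blast
    have "has_multiterm_deriv l q \<alpha> (\<lambda>t. norm (e t) - w t) s (D - d)"
      by (rule has_multiterm_deriv_diff[OF D(1) d(1)])
    moreover have "(D - d) + lam * (norm (e s) - w s) \<le> 0"
      using D(2) d(2) by (simp add: algebra_simps)
    ultimately show "\<exists>d. has_multiterm_deriv l q \<alpha> (\<lambda>t. norm (e t) - w t) s d \<and>
        d + lam * (norm (e s) - w s) \<le> 0" by blast
  qed
  then show ?thesis by (auto simp: e_def)
qed

end
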